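(* Let $\Pi$ be an $\mathsf{LCL}$ problem for which no certificate for $O(\log^* n)$ solvability exists. Then the randomized and the deterministic complexity of $\Pi$ in the $\mathsf{LOCAL}$ model (on $n$-node full $\delta$-ary rooted trees) is $\Omega(\log n)$.
   Context: An $\mathsf{LCL}$ problem is a triple $\Pi=(\delta,\Sigma(\Pi),\mathcal C(\Pi))$ where $\delta\ge 1$ is an integer, $\Sigma(\Pi)$ is a finite set of labels, and $\mathcal C(\Pi)\subseteq\Sigma(\Pi)^{\delta+1}$ is a set of allowed configurations, written $(a:b_1,\dots,b_\delta)$; the order of $b_1,\dots,b_\delta$ is irrelevant. Inputs are unlabeled full $\delta$-ary rooted trees (every node has exactly $\delta$ or $0$ children). A labeling $\lambda$ of the nodes of a tree by $\Sigma(\Pi)$ is correct (a solution) if for every node $v$ with $\delta$ children $v_1,\dots,v_\delta$ there is a permutation $\rho$ of $\{1,\dots,\delta\}$ with $(\lambda(v):\lambda(v_{\rho(1)}),\dots,\lambda(v_{\rho(\delta)}))\in\mathcal C(\Pi)$; nodes whose number of children is not $\delta$ are unconstrained. (Uniform) certificate for $O(\log^* n)$ solvability: a nonempty label set $\Sigma_{\mathcal T}=\{\sigma_1,\dots,\sigma_t\}\subseteq\Sigma(\Pi)$, a depth $d\ge 1$, and labeled trees $\mathcal T_1,\dots,\mathcal T_t$ such that (1) each $\mathcal T_i$ is a complete $\delta$-ary tree of depth $d$ (every non-leaf has $\delta$ children, all leaves at distance $d$ from the root); (2) each $\mathcal T_i$ is labeled with labels from $\Sigma_{\mathcal T}$ and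 is correct with respect to $\mathcal C(\Pi)$; (3) the trees obtained from the $\mathcal T_i$ by erasing the labels of all non-leaf nodes are all isomorphic as rooted trees with labeled leaves; (4) the root of $\mathcal T_i$ is labeled $\sigma_i$. Model. In $\mathsf{LOCAL}$ on an $n$-node graph each node has a unique identifier from $\{1,\dots,\mathrm{poly}(n)\}$ and initially knows its identifier, its degree, $n$, the maximum degree, and which incident edge leads to its parent. In synchronous rounds nodes exchange unbounded messages with neighbors and do unbounded local computation; each node eventually outputs its label. The running time is the number of rounds until all nodes have output. In the randomized version each node has its own stream of random bits and the global output must be correct with probability at least $1-1/n$. The complexity of $\Pi$ is the best worst-case running time, as a function of $n$, of an algorithm solving $\Pi$. *)

theory Defs
  imports
    "HOL-Probability.Probability"
    "HOL-Combinatorics.Permutations"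
    "HOL-Library.Landau_Symbols"
begin

section \<open>Rooted trees\<close>

text \<open>
  A node is addressed by the list of child indices on the path from the root \<open>[]\<close> to it, so the
  children of \<open>v\<close> are \<open>v @ [0], v @ [1], \<dots>\<close> and the depth of \<open>v\<close> is \<open>length v\<close>. Every finite
  rooted tree is isomorphic to a tree of this shape. The order of the children is not part of the
  mathematical input; it only serves as the (arbitrary) numbering of the edges through which a node
  addresses its children in the communication model below.
\<close>

type_synonym node = "nat list"

definition rooted_tree :: "node set \<Rightarrow> bool" where
  "rooted_tree V \<longleftrightarrow> finite V \<and> [] \<in> V \<and>
     (\<forall>v i. v @ [i] \<in> V \<longrightarrow> v \<in> V \<and> (\<forall>j<i. v @ [j] \<in> V))"

definition child_of :: "node \<Rightarrow> node \<Rightarrow> bool" where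
  "child_of u v \<longleftrightarrow> (\<exists>i. u = v @ [i])"

definition num_children :: "node set \<Rightarrow> node \<Rightarrow> nat" where
  "num_children V v = card {u \<in> V. child_of u v}"

definition leaf :: "node set \<Rightarrow> node \<Rightarrow> bool" where
  "leaf V v \<longleftrightarrow> num_children V v = 0"

definition full_tree :: "nat \<Rightarrow> node set \<Rightarrow> bool" where
  "full_tree \<delta> V \<longleftrightarrow> rooted_tree V \<and> (\<forall>v\<in>V. num_children V v \<in> {0, \<delta>})"

definition complete_tree :: "nat \<Rightarrow> nat \<Rightarrow> node set \<Rightarrow> bool" where
  "complete_tree \<delta> d V \<longleftrightarrow> rooted_tree V \<and>
     (\<forall>v\<in>V. \<not> leaf V v \<longrightarrow> num_children V v = \<delta>) \<and>
     (\<forall>v\<in>V. leaf V v \<longrightarrow> length v = d)"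

text \<open>Isomorphism of rooted trees all of whose labels except those of the leaves are erased.\<close>

definition leaf_labeled_iso ::
  "node set \<Rightarrow> (node \<Rightarrow> 'a) \<Rightarrow> node set \<Rightarrow> (node \<Rightarrow> 'a) \<Rightarrow> bool" where
  "leaf_labeled_iso V \<kappa> W \<mu> \<longleftrightarrow> (\<exists>f. bij_betw f V W \<and> f [] = [] \<and>
     (\<forall>u\<in>V. \<forall>v\<in>V. child_of (f u) (f v) \<longleftrightarrow> child_of u v) \<and>
     (\<forall>v\<in>V. leaf V v \<longrightarrow> \<mu> (f v) = \<kappa> v))"


section \<open>LCL problems and certificates\<close>

text \<open>A configuration \<open>(a : b\<^sub>1, \<dots>, b\<^sub>\<delta>)\<close> is represented as \<open>(a, [b\<^sub>1, \<dots>, b\<^sub>\<delta>])\<close>.\<close>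

record 'a lcl_problem =
  arity :: nat
  labels :: "'a set"
  configs :: "('a \<times> 'a list) set"

definition lcl :: "'a lcl_problem \<Rightarrow> bool" where
  "lcl P \<longleftrightarrow> arity P \<ge> 1 \<and> finite (labels P) \<and>
     configs P \<subseteq> labels P \<times> {bs. set bs \<subseteq> labels P \<and> length bs = arity P}"

definition correct :: "'a lcl_problem \<Rightarrow> node set \<Rightarrow> (node \<Rightarrow> 'a) \<Rightarrow> bool" where
  "correct P V \<mu> \<longleftrightarrow> \<mu> ` V \<subseteq> labels P \<and>
     (\<forall>v\<in>V. num_children V v = arity P \<longrightarrow>
        (\<exists>\<rho>. \<rho> permutes {..<arity P} \<and>
           (\<mu> v, map (\<lambda>i. \<mu> (v @ [\<rho> i])) [0..<arity P]) \<in> configs P))"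

text \<open>
  The trees of a certificate are indexed by the labels \<open>\<sigma> \<in> S\<close> themselves instead of \<open>1, \<dots>, t\<close>.
\<close>

definition logstar_certificate ::
  "'a lcl_problem \<Rightarrow> 'a set \<Rightarrow> nat \<Rightarrow> ('a \<Rightarrow> node set) \<Rightarrow> ('a \<Rightarrow> node \<Rightarrow> 'a) \<Rightarrow> bool" where
  "logstar_certificate P S d V \<mu> \<longleftrightarrow>
     S \<noteq> {} \<and> S \<subseteq> labels P \<and> d \<ge> 1 \<and>
     (\<forall>\<sigma>\<in>S. complete_tree (arity P) d (V \<sigma>)) \<and>
     (\<forall>\<sigma>\<in>S. \<mu> \<sigma> ` V \<sigma> \<subseteq> S \<and> correct P (V \<sigma>) (\<mu> \<sigma>)) \<and>
     (\<forall>\<sigma>\<in>S. \<forall>\<tau>\<in>S. leaf_labeled_iso (V \<sigma>) (\<mu> \<sigma>) (V \<tau>) (\<mu> \<tau>)) \<and>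
     (\<forall>\<sigma>\<in>S. \<mu> \<sigma> [] = \<sigma>)"

definition has_logstar_certificate :: "'a lcl_problem \<Rightarrow> bool" where
  "has_logstar_certificate P \<longleftrightarrow> (\<exists>S d V \<mu>. logstar_certificate P S d V \<mu>)"


section \<open>The LOCAL model on rooted trees\<close>

text \<open>
  The incident edges of a node are \<open>Up\<close> (to its parent, absent at the root) and \<open>Down i\<close> (to its
  \<open>i\<close>-th child). Messages and states are of arbitrary types \<open>'m\<close> and \<open>'s\<close>, and the functions of an
  algorithm are arbitrary. The type \<open>'i\<close> describes what a node knows initially; in the randomized model
  this includes its stream of random bits.
\<close>

datatype edge = Up | Down nat

record ('i, 's, 'm, 'a) algorithm =
  init :: "'i \<Rightarrow> 's"
  send :: "'s \<Rightarrow> edge \<Rightarrow> 'm"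
  step :: "'s \<Rightarrow> (edge \<Rightarrow> 'm option) \<Rightarrow> 's"
  decision :: "'s \<Rightarrow> 'a option"

fun inbox :: "('i, 's, 'm, 'a) algorithm \<Rightarrow> node set \<Rightarrow> (node \<Rightarrow> 's) \<Rightarrow> node \<Rightarrow> edge \<Rightarrow> 'm option"
  where
  "inbox A V s v Up =
     (if v \<noteq> [] then Some (send A (s (butlast v)) (Down (last v))) else None)"
| "inbox A V s v (Down i) =
     (if v @ [i] \<in> V then Some (send A (s (v @ [i])) Up) else None)"

text \<open>\<open>state A V x t v\<close> is the state of \<open>v\<close> after \<open>t\<close> rounds if initially every \<open>u\<close> knows \<open>x u\<close>.\<close>

primrec state ::
  "('i, 's, 'm, 'a) algorithm \<Rightarrow> node set \<Rightarrow> (node \<Rightarrow> 'i) \<Rightarrow> nat \<Rightarrow> node \<Rightarrow> 's" where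
  "state A V x 0 = (\<lambda>v. init A (x v))"
| "state A V x (Suc t) =
     (\<lambda>v. step A (state A V x t v) (inbox A V (state A V x t) v))"

definition has_output ::
  "('i, 's, 'm, 'a) algorithm \<Rightarrow> node set \<Rightarrow> (node \<Rightarrow> 'i) \<Rightarrow> nat \<Rightarrow> node \<Rightarrow> bool" where
  "has_output A V x t v \<longleftrightarrow> decision A (state A V x t v) \<noteq> None"

text \<open>
  Outputs are irrevocable: the first one counts. A node that has produced its output keeps
  exchanging messages. \<open>None\<close> means that the node never outputs a label.
\<close>

definition final_output ::
  "('i, 's, 'm, 'a) algorithm \<Rightarrow> node set \<Rightarrow> (node \<Rightarrow> 'i) \<Rightarrow> node \<Rightarrow> 'a option" where
  "final_output A V x v =
     (if \<exists>t. has_output A V x t v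
      then decision A (state A V x (LEAST t. has_output A V x t v) v) else None)"

definition solved ::
  "'a lcl_problem \<Rightarrow> ('i, 's, 'm, 'a) algorithm \<Rightarrow> node set \<Rightarrow> (node \<Rightarrow> 'i) \<Rightarrow> bool" where
  "solved P A V x \<longleftrightarrow> (\<forall>v\<in>V. final_output A V x v \<noteq> None) \<and>
     correct P V (\<lambda>v. the (final_output A V x v))"

text \<open>The number of rounds until all nodes have output; \<open>\<infinity>\<close> if some node never does.\<close>

definition rounds :: "('i, 's, 'm, 'a) algorithm \<Rightarrow> node set \<Rightarrow> (node \<Rightarrow> 'i) \<Rightarrow> enat" where
  "rounds A V x = (SUP v\<in>V. INF t\<in>{t. has_output A V x t v}. enat t)"

record local_input =
  own_id :: nat
  own_degree :: nat
  num_nodes :: nat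
  maximum_degree :: nat
  is_root :: bool

definition deg :: "node set \<Rightarrow> node \<Rightarrow> nat" where
  "deg V v = num_children V v + (if v = [] then 0 else 1)"

definition local_input :: "node set \<Rightarrow> (node \<Rightarrow> nat) \<Rightarrow> node \<Rightarrow> local_input" where
  "local_input V ids v =
     \<lparr> own_id = ids v, own_degree = deg V v, num_nodes = card V,
       maximum_degree = Max (deg V ` V), is_root = (v = []) \<rparr>"

text \<open>
  Identifiers on \<open>n\<close>-node trees are drawn from \<open>{1..R n}\<close> for a fixed polynomially bounded \<open>R\<close>;
  \<open>n \<le> R n\<close> is what makes unique identifiers possible.
\<close>

definition poly_id_range :: "(nat \<Rightarrow> nat) \<Rightarrow> bool" where
  "poly_id_range R \<longleftrightarrow> (\<forall>n. n \<le> R n) \<and> (\<exists>k. (\<lambda>n. real (R n)) \<in> O(\<lambda>n. real n ^ k))"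

definition instances :: "nat \<Rightarrow> (nat \<Rightarrow> nat) \<Rightarrow> nat \<Rightarrow> (node set \<times> (node \<Rightarrow> nat)) set" where
  "instances \<delta> R n =
     {(V, ids). full_tree \<delta> V \<and> card V = n \<and> inj_on ids V \<and> ids ` V \<subseteq> {1..R n}}"


section \<open>Deterministic complexity\<close>

definition det_solves ::
  "'a lcl_problem \<Rightarrow> (nat \<Rightarrow> nat) \<Rightarrow> (local_input, 's, 'm, 'a) algorithm \<Rightarrow> bool" where
  "det_solves P R A \<longleftrightarrow>
     (\<forall>n. \<forall>(V, ids) \<in> instances (arity P) R n. solved P A V (local_input V ids))"

definition det_time ::
  "nat \<Rightarrow> (nat \<Rightarrow> nat) \<Rightarrow> (local_input, 's, 'm, 'a) algorithm \<Rightarrow> nat \<Rightarrow> enat" where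
  "det_time \<delta> R A n = (SUP (V, ids) \<in> instances \<delta> R n. rounds A V (local_input V ids))"

text \<open>
  The type arguments are the types of states and messages; HOL cannot quantify over them inside the
  infimum. The value is \<open>\<infinity>\<close> if no algorithm solves the problem.
\<close>

definition det_complexity ::
  "'s itself \<Rightarrow> 'm itself \<Rightarrow> 'a lcl_problem \<Rightarrow> (nat \<Rightarrow> nat) \<Rightarrow> nat \<Rightarrow> enat" where
  "det_complexity _ _ P R n =
     (INF A \<in> {A :: (local_input, 's, 'm, 'a) algorithm. det_solves P R A}.
        det_time (arity P) R A n)"


section \<open>Randomized complexity\<close>

type_synonym random_input = "local_input \<times> bool stream"

definition random_bits :: "node set \<Rightarrow> (node \<Rightarrow> bool stream) measure" where
  "random_bits V = PiM V (\<lambda>_. stream_space (measure_pmf (bernoulli_pmf (1/2))))"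

definition random_input ::
  "node set \<Rightarrow> (node \<Rightarrow> nat) \<Rightarrow> (node \<Rightarrow> bool stream) \<Rightarrow> node \<Rightarrow> random_input" where
  "random_input V ids \<omega> v = (local_input V ids v, \<omega> v)"

text \<open>
  The output of each node has to be a random variable, as otherwise the success probability need not
  make sense; every output that is computed from the bits in any reasonable way satisfies this.
\<close>

definition rand_solves ::
  "'a lcl_problem \<Rightarrow> (nat \<Rightarrow> nat) \<Rightarrow> (random_input, 's, 'm, 'a) algorithm \<Rightarrow> bool" where
  "rand_solves P R A \<longleftrightarrow>
     (\<forall>n. \<forall>(V, ids) \<in> instances (arity P) R n.
        (\<forall>v\<in>V. (\<lambda>\<omega>. final_output A V (random_input V ids \<omega>) v)
                  \<in> measurable (random_bits V) (count_space UNIV)) \<and>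
        measure (random_bits V)
          {\<omega> \<in> space (random_bits V). solved P A V (random_input V ids \<omega>)} \<ge> 1 - 1 / real n)"

text \<open>Worst case over the inputs and over the random bits.\<close>

definition rand_time ::
  "nat \<Rightarrow> (nat \<Rightarrow> nat) \<Rightarrow> (random_input, 's, 'm, 'a) algorithm \<Rightarrow> nat \<Rightarrow> enat" where
  "rand_time \<delta> R A n =
     (SUP (V, ids) \<in> instances \<delta> R n. SUP \<omega> \<in> space (random_bits V).
        rounds A V (random_input V ids \<omega>))"

definition rand_complexity ::
  "'s itself \<Rightarrow> 'm itself \<Rightarrow> 'a lcl_problem \<Rightarrow> (nat \<Rightarrow> nat) \<Rightarrow> nat \<Rightarrow> enat" where
  "rand_complexity _ _ P R n =
     (INF A \<in> {A :: (random_input, 's, 'm, 'a) algorithm. rand_solves P R A}.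
        rand_time (arity P) R A n)"


section \<open>Asymptotic lower bound\<close>

text \<open>
  \<open>f = \<Omega>(log n)\<close> as functions of the possible numbers of nodes \<open>n\<close> of full \<open>\<delta>\<close>-ary trees. For all
  other \<open>n\<close> (those not of the form \<open>1 + k * \<delta>\<close>) there are no inputs, and worst-case times are 0.
\<close>

definition Omega_log :: "nat \<Rightarrow> (nat \<Rightarrow> enat) \<Rightarrow> bool" where
  "Omega_log \<delta> f \<longleftrightarrow> (\<exists>c>0. \<exists>n0. \<forall>n\<ge>n0. (\<exists>V. full_tree \<delta> V \<and> card V = n) \<longrightarrow>
     ereal (c * ln (real n)) \<le> ereal_of_enat (f n))"

end

theory Submission
  imports Defs
begin

text \<open>
  Suppose that a randomized algorithm solves the problem in \<open>T\<close> rounds on \<open>n\<close>-node trees, where \<open>n\<close>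
  exceeds a certain power of the size of a complete tree of depth \<open>4T + 3\<close>. Let \<open>S\<close> be the set of labels
  that some node output with not too small a probability, for some choice of the identifiers around
  it. By the pigeonhole principle the threshold can be chosen such that every label outside \<open>S\<close> is far
  less likely than every label in \<open>S\<close>.

  For \<open>\<sigma> \<in> S\<close> take a node \<open>v\<close> that is likely to output \<open>\<sigma>\<close>, and give the nodes around level \<open>2T + 1\<close>
  below \<open>v\<close> identifiers that do not depend on \<open>\<sigma>\<close>. The outputs on that level are independent of the
  output of \<open>v\<close>, and their distribution does not depend on \<open>\<sigma>\<close>. A leaf labeling that never occurs
  together with output \<open>\<sigma>\<close> at \<open>v\<close> in a correct run that only uses labels from \<open>S\<close> therefore has
  small probability. Hence some leaf labeling is compatible with all \<open>\<sigma> \<in> S\<close> simultaneously, and the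
  corresponding runs form a certificate.

  So without a certificate \<open>n\<close> is at most exponential in \<open>T\<close>. Deterministic algorithms are a special
  case of randomized ones.
\<close>

subsection \<open>Full trees\<close>

definition complete_nodes :: "nat \<Rightarrow> nat \<Rightarrow> node set" where
  "complete_nodes \<delta> D = {u. set u \<subseteq> {..<\<delta>} \<and> length u \<le> D}"

lemma finite_complete_nodes [simp]: "finite (complete_nodes \<delta> D)"
  unfolding complete_nodes_def by (rule finite_lists_length_le) simp

lemma card_complete_nodes_le: "card (complete_nodes \<delta> D) \<le> (\<delta> + 1) ^ D"
proof -
  have "(\<Sum>i\<le>D. \<delta> ^ i) \<le> (\<delta> + 1) ^ D"
  proof (induction D)
    case (Suc D)
    have "\<delta> * \<delta> ^ D \<le> \<delta> * (\<delta> + 1) ^ D"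
      by (intro mult_left_mono power_mono) auto
    with Suc have "(\<Sum>i\<le>D. \<delta> ^ i) + \<delta> ^ Suc D \<le> (\<delta> + 1) ^ D + \<delta> * (\<delta> + 1) ^ D"
      by (intro add_mono) auto
    then show ?case by simp
  qed simp
  then show ?thesis
    unfolding complete_nodes_def by (subst card_lists_length_le) auto
qed

lemma num_children_eqI:
  assumes "\<And>i. v @ [i] \<in> V \<longleftrightarrow> i < k"
  shows "num_children V v = k"
proof -
  have "{u \<in> V. child_of u v} = (\<lambda>i. v @ [i]) ` {..<k}"
    using assms by (auto simp: child_of_def)
  then show ?thesis
    unfolding num_children_def by (simp add: card_image inj_on_def)
qed

text \<open>In a rooted tree the child indices are finite in number and downward closed, hence an
  initial segment of the naturals.\<close>

lemma child_iff_less_num_children: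
  assumes "rooted_tree V"
  shows "v @ [i] \<in> V \<longleftrightarrow> i < num_children V v"
proof -
  let ?I = "{i. v @ [i] \<in> V}"
  have "finite ((\<lambda>i. v @ [i]) -` V)"
    using assms unfolding rooted_tree_def by (intro finite_vimageI) (auto simp: inj_on_def)
  then have fin: "finite ?I" by (simp add: vimage_def)
  have "\<exists>k. ?I = {..<k}"
  proof (cases "?I = {}")
    case False
    have "?I = {..<Suc (Max ?I)}"
    proof (intro set_eqI iffI)
      fix j assume "j \<in> ?I"
      then show "j \<in> {..<Suc (Max ?I)}" using fin by (simp add: less_Suc_eq_le)
    next
      fix j assume "j \<in> {..<Suc (Max ?I)}"
      moreover have "v @ [Max ?I] \<in> V" using Max_in[OF fin False] by simp
      ultimately show "j \<in> ?I"
        using assms unfolding rooted_tree_def by (metis less_Suc_eq lessThan_iff mem_Collect_eq)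
    qed
    then show ?thesis by blast
  qed auto
  then obtain k where k: "\<And>i. v @ [i] \<in> V \<longleftrightarrow> i < k" by auto
  then show ?thesis using num_children_eqI[of v V k] by simp
qed

lemma rooted_tree_appendD: "rooted_tree V \<Longrightarrow> u @ w \<in> V \<Longrightarrow> u \<in> V"
proof (induction w rule: rev_induct)
  case (snoc i w)
  then show ?case unfolding rooted_tree_def by (metis append_assoc)
qed simp

lemma num_children_complete_nodes:
  assumes "v \<in> complete_nodes \<delta> D"
  shows "num_children (complete_nodes \<delta> D) v = (if length v < D then \<delta> else 0)"
  using assms by (intro num_children_eqI) (auto simp: complete_nodes_def)

lemma rooted_tree_complete_nodes: "rooted_tree (complete_nodes \<delta> D)"
  unfolding rooted_tree_def
  using finite_complete_nodes[of \<delta> D] by (auto simp: complete_nodes_def)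

lemma full_tree_complete_nodes: "full_tree \<delta> (complete_nodes \<delta> D)"
  unfolding full_tree_def
  by (auto simp: rooted_tree_complete_nodes num_children_complete_nodes)

lemma complete_tree_complete_nodes:
  assumes "\<delta> \<ge> 1"
  shows "complete_tree \<delta> D (complete_nodes \<delta> D)"
  unfolding complete_tree_def leaf_def
  using assms rooted_tree_complete_nodes num_children_complete_nodes
  by (auto simp: complete_nodes_def split: if_splits)

text \<open>Counting the non-root nodes by their parents gives a sum whose terms are all 0 or
  \<open>\<delta>\<close>.\<close>

lemma card_full_tree_mod:
  assumes "full_tree \<delta> V"
  shows "\<exists>k. card V = 1 + k * \<delta>"
proof -
  have rt: "rooted_tree V" and fin: "finite V" and root: "[] \<in> V"
    using assms unfolding full_tree_def rooted_tree_def by blast+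
  have "V - {[]} = (\<Union>v\<in>V. {u \<in> V. child_of u v})"
  proof (intro set_eqI iffI)
    fix u assume u: "u \<in> V - {[]}"
    then obtain w i where "u = w @ [i]" by (cases u rule: rev_cases) auto
    then show "u \<in> (\<Union>v\<in>V. {u \<in> V. child_of u v})"
      using u rooted_tree_appendD[OF rt, of w "[i]"] by (auto simp: child_of_def)
  qed (auto simp: child_of_def)
  then have "card (V - {[]}) = (\<Sum>v\<in>V. num_children V v)"
    unfolding num_children_def using fin
    by (simp only:, subst card_UN_disjoint) (auto simp: child_of_def)
  also have "\<delta> dvd \<dots>"
    using assms by (intro dvd_sum) (auto simp: full_tree_def)
  finally obtain k where "card (V - {[]}) = k * \<delta>" by (metis dvd_def mult.commute)
  moreover have "card V = Suc (card (V - {[]}))"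
    using fin root by (metis card.remove)
  ultimately show ?thesis by auto
qed

text \<open>Giving \<open>\<delta>\<close> children to a deepest node preserves fullness, and such a
  node is too deep for the first \<open>D\<close> levels to change.\<close>

lemma full_tree_extend:
  assumes "\<delta> \<ge> 1"
  shows "\<exists>V. full_tree \<delta> V \<and> card V = card (complete_nodes \<delta> D) + k * \<delta> \<and>
           (\<forall>u. length u \<le> D \<longrightarrow> (u \<in> V \<longleftrightarrow> set u \<subseteq> {..<\<delta>}))"
proof (induction k)
  case 0
  show ?case
    using full_tree_complete_nodes by (intro exI[of _ "complete_nodes \<delta> D"])
      (auto simp: complete_nodes_def)
next
  case (Suc k)
  then obtain V where V: "full_tree \<delta> V" "card V = card (complete_nodes \<delta> D) + k * \<delta>"
    "\<And>u. length u \<le> D \<Longrightarrow> u \<in> V \<longleftrightarrow> set u \<subseteq> {..<\<delta>}" by auto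
  have rt: "rooted_tree V" and fin: "finite V" "V \<noteq> {}"
    using V(1) unfolding full_tree_def rooted_tree_def by blast+
  obtain u where u: "u \<in> V" "\<And>w. w \<in> V \<Longrightarrow> length w \<le> length u"
  proof -
    obtain u where u: "u \<in> V" "Max (length ` V) = length u" using obtains_MAX[OF fin] .
    show thesis using that[OF u(1)] Max_ge[of "length ` V"] fin(1) u(2) by simp
  qed
  \<comment> \<open>The leftmost path reaches level \<open>D\<close>, so the new children below
    \<open>u\<close> have depth larger than \<open>D\<close>.\<close>
  have "replicate D 0 \<in> V" using V(3)[of "replicate D 0"] assms by (auto split: if_splits)
  then have uD: "D \<le> length u" using u(2) by force
  have notin: "u @ w \<notin> V" if "w \<noteq> []" for w using u(2)[of "u @ w"] that by auto
  let ?C = "(\<lambda>i. u @ [i]) ` {..<\<delta>}"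
  let ?V = "V \<union> ?C"
  have rtV: "rooted_tree ?V"
    unfolding rooted_tree_def
  proof (intro conjI allI impI)
    fix v i assume "v @ [i] \<in> ?V"
    then consider "v @ [i] \<in> V" | "v = u" "i < \<delta>" by auto
    then show "v \<in> ?V" "\<And>j. j < i \<Longrightarrow> v @ [j] \<in> ?V"
      using rooted_tree_appendD[OF rt, of v "[i]"] child_iff_less_num_children[OF rt, of v] u(1)
      by (cases; auto)+
  next
    show "finite ?V" using fin by simp
    show "[] \<in> ?V" using rt unfolding rooted_tree_def by blast
  qed
  have nc: "num_children ?V v \<in> {0, \<delta>}" if v: "v \<in> ?V" for v
  proof -
    consider "v = u" | "v \<in> V" "v \<noteq> u" | i where "v = u @ [i]" "i < \<delta>" using v by auto
    then show ?thesis
    proof cases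
      case 1
      then have "num_children ?V v = \<delta>" by (intro num_children_eqI) (auto simp: notin)
      then show ?thesis by simp
    next
      case 2
      then have "num_children ?V v = num_children V v"
        by (intro num_children_eqI) (auto simp: child_iff_less_num_children[OF rt])
      then show ?thesis using V(1) 2 by (simp add: full_tree_def)
    next
      case 3
      then have "num_children ?V v = 0" using notin by (intro num_children_eqI) auto
      then show ?thesis by simp
    qed
  qed
  have "card ?V = card V + card ?C"
    using fin by (intro card_Un_disjoint) (auto simp: notin)
  then have "card ?V = card (complete_nodes \<delta> D) + Suc k * \<delta>"
    using V(2) by (simp add: card_image inj_on_def)
  moreover have "\<forall>w. length w \<le> D \<longrightarrow> (w \<in> ?V \<longleftrightarrow> set w \<subseteq> {..<\<delta>})"
  proof (intro allI impI)
    fix w :: node assume w: "length w \<le> D"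
    then have "w \<notin> ?C" using uD by auto
    then show "w \<in> ?V \<longleftrightarrow> set w \<subseteq> {..<\<delta>}" using V(3)[OF w] by blast
  qed
  moreover have "full_tree \<delta> ?V" unfolding full_tree_def by (intro conjI ballI rtV nc)
  ultimately show ?case by (intro exI[of _ ?V] conjI)
qed

text \<open>The bound is claimed for every feasible size, so the hard instance must have exactly the
  given number of nodes. Both sizes are 1 modulo \<open>\<delta>\<close>, so their difference can be
  filled up.\<close>

lemma ex_full_tree_complete_top:
  assumes "\<delta> \<ge> 1" "full_tree \<delta> V" "card (complete_nodes \<delta> D) \<le> card V"
  shows "\<exists>W. full_tree \<delta> W \<and> card W = card V \<and>
           (\<forall>u. length u \<le> D \<longrightarrow> (u \<in> W \<longleftrightarrow> set u \<subseteq> {..<\<delta>}))"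
proof -
  obtain k where k: "card V = 1 + k * \<delta>" using card_full_tree_mod[OF assms(2)] by blast
  obtain l where l: "card (complete_nodes \<delta> D) = 1 + l * \<delta>"
    using card_full_tree_mod[OF full_tree_complete_nodes] by blast
  have "l \<le> k" using k l assms by simp
  then have "card V = card (complete_nodes \<delta> D) + (k - l) * \<delta>"
    using k l by (simp add: diff_mult_distrib)
  then show ?thesis using full_tree_extend[OF assms(1)] by metis
qed

lemma inj_on_extend:
  assumes "finite C" "finite V" "X \<subseteq> V" "inj_on f X" "f ` X \<subseteq> C" "card V \<le> card C"
  shows "\<exists>g. inj_on g V \<and> g ` V \<subseteq> C \<and> (\<forall>x\<in>X. g x = f x)"
proof -
  have fX: "finite X" using assms finite_subset by blast
  have "card (V - X) \<le> card (C - f ` X)"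
    using assms fX by (simp add: card_Diff_subset card_image diff_le_mono)
  then obtain h where h: "inj_on h (V - X)" "h ` (V - X) \<subseteq> C - f ` X"
    using card_le_inj[of "V - X" "C - f ` X"] assms(1,2) by blast
  let ?g = "\<lambda>x. if x \<in> X then f x else h x"
  have "inj_on ?g (X \<union> (V - X))"
    unfolding inj_on_Un
  proof (intro conjI)
    show "inj_on ?g X" "inj_on ?g (V - X)" using assms(4) h(1) by (auto simp: inj_on_def)
    have "?g ` (X - (V - X)) \<subseteq> f ` X" "?g ` (V - X - X) \<subseteq> C - f ` X" using h(2) by auto
    then show "?g ` (X - (V - X)) \<inter> ?g ` (V - X - X) = {}" by blast
  qed
  then have "inj_on ?g V" using assms(3) by (simp add: Un_absorb1)
  moreover have "?g ` V \<subseteq> C" using h(2) assms(5) by auto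
  ultimately show ?thesis by (intro exI[of _ ?g]) simp
qed

subsection \<open>Locality\<close>

text \<open>
  Instead of balls of radius \<open>T\<close> in the tree, all nodes of the surrounding levels are considered; this
  suffices here and does not depend on the address \<open>q\<close>. The node \<open>p\<close> itself is excluded because it
  may or may not be the root.
\<close>

lemma state_local:
  assumes top: "\<And>u. length u \<le> D \<Longrightarrow> u \<in> V \<longleftrightarrow> set u \<subseteq> {..<\<delta>}"
    and p: "set p \<subseteq> {..<\<delta>}" "length p + 2 * T + 1 \<le> D"
    and p': "set p' \<subseteq> {..<\<delta>}" "length p' + 2 * T + 1 \<le> D"
    and xy: "\<And>w. \<lbrakk>set w \<subseteq> {..<\<delta>}; 1 \<le> length w; length w \<le> 2 * T + 1\<rbrakk> \<Longrightarrow> x (p @ w) = y (p' @ w)"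
    and q: "set q \<subseteq> {..<\<delta>}" "t + 1 \<le> length q" "length q + t \<le> 2 * T + 1"
  shows "state A V x t (p @ q) = state A V y t (p' @ q)"
  using q
proof (induction t arbitrary: q)
  case 0
  then show ?case using xy[of q] by simp
next
  case (Suc t)
  \<comment> \<open>The range allowed for \<open>length q\<close> loses one level at both ends per
    round, so the parent and the children of \<open>p @ q\<close> are covered by the induction
    hypothesis. The bound \<open>D\<close> leaves room for the children.\<close>
  have "inbox A V (state A V x t) (p @ q) e = inbox A V (state A V y t) (p' @ q) e" for e
  proof (cases e)
    case Up
    have "state A V x t (p @ butlast q) = state A V y t (p' @ butlast q)"
      using Suc.prems by (intro Suc.IH) (auto dest: in_set_butlastD)
    then show ?thesis using Suc.prems Up by (auto simp: butlast_append)
  next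
    case (Down i)
    have "(p @ q) @ [i] \<in> V \<longleftrightarrow> i < \<delta>" "(p' @ q) @ [i] \<in> V \<longleftrightarrow> i < \<delta>"
      using Suc.prems p p' top[of "(p @ q) @ [i]"] top[of "(p' @ q) @ [i]"] by auto
    moreover have "state A V x t (p @ (q @ [i])) = state A V y t (p' @ (q @ [i]))" if "i < \<delta>"
      using Suc.prems that by (intro Suc.IH) auto
    ultimately show ?thesis using Down by simp
  qed
  moreover have "state A V x t (p @ q) = state A V y t (p' @ q)"
    using Suc.prems by (intro Suc.IH) auto
  ultimately show ?case by simp presburger
qed

text \<open>The first output counts and occurs within \<open>T\<close> rounds, so later states are
  irrelevant.\<close>

lemma final_output_eqI:
  assumes "\<And>t. t \<le> T \<Longrightarrow> state A V x t u = state A V y t v"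
    and "\<exists>t\<le>T. has_output A V x t u"
  shows "final_output A V x u = final_output A V y v"
proof -
  have eq: "has_output A V x t u \<longleftrightarrow> has_output A V y t v" if "t \<le> T" for t
    using assms(1)[OF that] by (simp add: has_output_def)
  obtain t0 where t0: "t0 \<le> T" "has_output A V x t0 u" using assms(2) by blast
  let ?t = "LEAST t. has_output A V x t u"
  have t: "has_output A V x ?t u" "?t \<le> T"
    using t0 LeastI[of "\<lambda>t. has_output A V x t u"] Least_le[of "\<lambda>t. has_output A V x t u" t0] by auto
  have "(LEAST t. has_output A V y t v) = ?t"
  proof (rule Least_equality)
    show "has_output A V y ?t v" using eq t by simp
    show "?t \<le> s" if "has_output A V y s v" for s
      using that eq t by (metis Least_le le_trans nat_le_linear)
  qed
  then show ?thesis
    using t eq[OF t(2)] assms(1)[OF t(2)] unfolding final_output_def by metis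
qed

lemma rounds_le_enatD:
  assumes "rounds A V x \<le> enat T" "v \<in> V"
  shows "\<exists>t\<le>T. has_output A V x t v"
proof -
  have "(INF t\<in>{t. has_output A V x t v}. enat t) < enat (Suc T)"
    using assms unfolding rounds_def
    by (metis (no_types, lifting) SUP_upper enat_ord_simps(2) le_less_trans lessI)
  then show ?thesis by (auto simp: INF_less_iff less_Suc_eq_le)
qed

subsection \<open>Events determined by the random bits of some nodes\<close>

abbreviation bit_streams :: "bool stream measure" where
  "bit_streams \<equiv> stream_space (measure_pmf (bernoulli_pmf (1/2)))"

lemma prob_space_bit_streams: "prob_space bit_streams"
  by (rule prob_space.prob_space_stream_space) (rule prob_space_measure_pmf)

lemma space_random_bits: "space (random_bits V) = extensional V"
  by (auto simp: random_bits_def space_PiM space_stream_space PiE_def)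

lemma prob_space_random_bits: "prob_space (random_bits V)"
  unfolding random_bits_def by (intro prob_space_PiM prob_space_bit_streams)

text \<open>The streams are independent and identically distributed, so any injective selection of
  them has the same joint law.\<close>

lemma random_bits_reindex:
  assumes "inj_on f K" "f ` K \<subseteq> V"
  shows "distr (random_bits V) (random_bits K) (\<lambda>\<omega>. \<lambda>k\<in>K. \<omega> (f k)) = random_bits K"
  unfolding random_bits_def
  using distr_PiM_reindex[of V "\<lambda>_. bit_streams" f K] assms prob_space_bit_streams by auto

lemma measurable_reindex:
  assumes "f ` K \<subseteq> V"
  shows "(\<lambda>\<omega>. \<lambda>k\<in>K. \<omega> (f k)) \<in> measurable (random_bits V) (random_bits K)"
  unfolding random_bits_def using assms
  by (intro measurable_restrict measurable_component_singleton) auto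

text \<open>Filling the unused coordinates with a constant shows that an event is determined by
  coordinates already as a member of the small product algebra.\<close>

lemma dependent_event_preimage:
  assumes \<Phi>: "\<Phi> \<in> sets (random_bits V)" and f: "inj_on f (K :: node set)" "f ` K \<subseteq> V"
  obtains E where "E \<in> sets (random_bits K)"
    "\<And>W \<Psi> g. \<lbrakk>g ` K \<subseteq> W; \<Psi> \<subseteq> space (random_bits W);
      \<And>\<omega> \<omega>'. \<lbrakk>\<omega> \<in> space (random_bits V); \<omega>' \<in> space (random_bits W);
         \<And>k. k \<in> K \<Longrightarrow> \<omega> (f k) = \<omega>' (g k)\<rbrakk> \<Longrightarrow> \<omega> \<in> \<Phi> \<longleftrightarrow> \<omega>' \<in> \<Psi>\<rbrakk>
      \<Longrightarrow> \<Psi> = (\<lambda>\<omega>. \<lambda>k\<in>K. \<omega> (g k)) -` E \<inter> space (random_bits W)"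
proof
  define h :: "(node \<Rightarrow> bool stream) \<Rightarrow> node \<Rightarrow> bool stream" where
    "h \<beta> = (\<lambda>v\<in>V. if v \<in> f ` K then \<beta> (the_inv_into K f v) else undefined)" for \<beta>
  have h_space: "h \<beta> \<in> space (random_bits V)" for \<beta>
    by (simp add: space_random_bits h_def)
  have h_f: "h \<beta> (f k) = \<beta> k" if "k \<in> K" for \<beta> k
    using that f by (auto simp: h_def the_inv_into_f_f)
  have h_meas: "h \<in> measurable (random_bits K) (random_bits V)"
    unfolding h_def random_bits_def
  proof (rule measurable_restrict)
    fix v assume "v \<in> V"
    show "(\<lambda>\<beta>. if v \<in> f ` K then \<beta> (the_inv_into K f v) else undefined)
        \<in> measurable (PiM K (\<lambda>_. bit_streams)) bit_streams"
    proof (cases "v \<in> f ` K")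
      case True
      then have "the_inv_into K f v \<in> K" using f by (auto simp: the_inv_into_f_f)
      then show ?thesis using True by (simp add: measurable_component_singleton)
    next
      case False
      then show ?thesis by (simp add: space_stream_space)
    qed
  qed
  let ?E = "h -` \<Phi> \<inter> space (random_bits K)"
  show "?E \<in> sets (random_bits K)" using h_meas \<Phi> by (rule measurable_sets)
  fix W \<Psi> g
  assume g: "g ` K \<subseteq> W" "\<Psi> \<subseteq> space (random_bits W)"
    and dep: "\<And>\<omega> \<omega>'. \<lbrakk>\<omega> \<in> space (random_bits V); \<omega>' \<in> space (random_bits W);
         \<And>k. k \<in> K \<Longrightarrow> \<omega> (f k) = \<omega>' (g k)\<rbrakk> \<Longrightarrow> \<omega> \<in> \<Phi> \<longleftrightarrow> \<omega>' \<in> \<Psi>"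
  have "\<omega> \<in> \<Psi> \<longleftrightarrow> (\<lambda>k\<in>K. \<omega> (g k)) \<in> ?E" if "\<omega> \<in> space (random_bits W)" for \<omega>
  proof -
    have "h (\<lambda>k\<in>K. \<omega> (g k)) \<in> \<Phi> \<longleftrightarrow> \<omega> \<in> \<Psi>"
      using that h_space by (intro dep) (auto simp: h_f)
    then show ?thesis by (simp add: space_random_bits)
  qed
  then show "\<Psi> = (\<lambda>\<omega>. \<lambda>k\<in>K. \<omega> (g k)) -` ?E \<inter> space (random_bits W)"
    using g(2) by blast
qed

definition determined_by :: "node set \<Rightarrow> node set \<Rightarrow> (node \<Rightarrow> bool stream) set \<Rightarrow> bool" where
  "determined_by V X \<Phi> \<longleftrightarrow> X \<subseteq> V \<and>
     (\<forall>\<omega>\<in>space (random_bits V). \<forall>\<omega>'\<in>space (random_bits V).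
        (\<forall>v\<in>X. \<omega> v = \<omega>' v) \<longrightarrow> (\<omega> \<in> \<Phi> \<longleftrightarrow> \<omega>' \<in> \<Phi>))"

lemma determined_byD:
  assumes "determined_by V X \<Phi>"
  shows "X \<subseteq> V"
    "\<lbrakk>\<omega> \<in> space (random_bits V); \<omega>' \<in> space (random_bits V); \<And>v. v \<in> X \<Longrightarrow> \<omega> v = \<omega>' v\<rbrakk>
      \<Longrightarrow> \<omega> \<in> \<Phi> \<longleftrightarrow> \<omega>' \<in> \<Phi>"
  using assms unfolding determined_by_def by blast+

text \<open>Both events are preimages of one event \<open>E\<close> on the bits indexed by
  \<open>K\<close>, read off along \<open>f\<close> and along \<open>g\<close>; hence both have its
  probability.\<close>

lemma random_bits_transfer:
  assumes \<Phi>: "\<Phi> \<in> sets (random_bits V)" and \<Psi>: "\<Psi> \<in> sets (random_bits V)"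
    and f: "inj_on f (K :: node set)" "f ` K \<subseteq> V" and g: "inj_on g K" "g ` K \<subseteq> V"
    and dep: "\<And>\<omega> \<omega>'. \<lbrakk>\<omega> \<in> space (random_bits V); \<omega>' \<in> space (random_bits V);
         \<And>k. k \<in> K \<Longrightarrow> \<omega> (f k) = \<omega>' (g k)\<rbrakk> \<Longrightarrow> \<omega> \<in> \<Phi> \<longleftrightarrow> \<omega>' \<in> \<Psi>"
  shows "measure (random_bits V) \<Phi> = measure (random_bits V) \<Psi>"
proof (rule dependent_event_preimage[OF \<Phi> f])
  fix E assume E: "E \<in> sets (random_bits K)"
    and pre: "\<And>W \<Psi> g. \<lbrakk>g ` K \<subseteq> W; \<Psi> \<subseteq> space (random_bits W);
      \<And>\<omega> \<omega>'. \<lbrakk>\<omega> \<in> space (random_bits V); \<omega>' \<in> space (random_bits W);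
         \<And>k. k \<in> K \<Longrightarrow> \<omega> (f k) = \<omega>' (g k)\<rbrakk> \<Longrightarrow> \<omega> \<in> \<Phi> \<longleftrightarrow> \<omega>' \<in> \<Psi>\<rbrakk>
      \<Longrightarrow> \<Psi> = (\<lambda>\<omega>. \<lambda>k\<in>K. \<omega> (g k)) -` E \<inter> space (random_bits W)"
  have eq: "measure (random_bits V) \<Theta> = measure (random_bits K) E"
    if "\<Theta> = (\<lambda>\<omega>. \<lambda>k\<in>K. \<omega> (r k)) -` E \<inter> space (random_bits V)" "inj_on r K" "r ` K \<subseteq> V" for r \<Theta>
    using measure_distr[OF measurable_reindex[OF that(3)] E] random_bits_reindex[OF that(2,3)] that(1)
    by simp
  \<comment> \<open>The hypothesis compares \<open>\<Phi>\<close> only with \<open>\<Psi>\<close>.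
    Two points are compared through a third one that carries their common bits at the positions
    \<open>g k\<close>.\<close>
  have self: "\<omega>1 \<in> \<Phi> \<longleftrightarrow> \<omega>2 \<in> \<Phi>"
    if sp: "\<omega>1 \<in> space (random_bits V)" "\<omega>2 \<in> space (random_bits V)"
      and agree: "\<And>k. k \<in> K \<Longrightarrow> \<omega>1 (f k) = \<omega>2 (f k)" for \<omega>1 \<omega>2
  proof -
    let ?\<omega> = "\<lambda>v\<in>V. if v \<in> g ` K then \<omega>1 (f (the_inv_into K g v)) else undefined"
    have eqk: "?\<omega> (g k) = \<omega>1 (f k)" if "k \<in> K" for k using that g by (auto simp: the_inv_into_f_f)
    have "\<omega>1 \<in> \<Phi> \<longleftrightarrow> ?\<omega> \<in> \<Psi>"
      using sp(1) eqk by (intro dep) (auto simp: space_random_bits simp del: restrict_apply)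
    moreover have "\<omega>2 \<in> \<Phi> \<longleftrightarrow> ?\<omega> \<in> \<Psi>"
      using sp(2) eqk agree by (intro dep) (auto simp: space_random_bits simp del: restrict_apply)
    ultimately show ?thesis by simp
  qed
  have "\<Phi> = (\<lambda>\<omega>. \<lambda>k\<in>K. \<omega> (f k)) -` E \<inter> space (random_bits V)"
    by (rule pre[OF f(2) sets.sets_into_space[OF \<Phi>] self])
  moreover have "\<Psi> = (\<lambda>\<omega>. \<lambda>k\<in>K. \<omega> (g k)) -` E \<inter> space (random_bits V)"
    by (rule pre[OF g(2) sets.sets_into_space[OF \<Psi>] dep])
  ultimately show ?thesis using eq[OF _ f] eq[OF _ g] by simp
qed

text \<open>The coordinates of a product measure are independent, hence so are the restrictions to
  disjoint blocks, and each event is a preimage under one of these restrictions.\<close>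

lemma random_bits_indep:
  assumes \<Phi>: "\<Phi> \<in> sets (random_bits V)" "determined_by V X \<Phi>"
    and \<Psi>: "\<Psi> \<in> sets (random_bits V)" "determined_by V Y \<Psi>"
    and disj: "X \<inter> Y = {}"
  shows "measure (random_bits V) (\<Phi> \<inter> \<Psi>) = measure (random_bits V) \<Phi> * measure (random_bits V) \<Psi>"
\<comment> \<open>The criterion for independence used below needs a nonempty index set; for the
  empty one the space is a single point.\<close>
proof (cases "V = {}")
  case True
  interpret prob_space "random_bits V" by (rule prob_space_random_bits)
  have "space (random_bits V) = {\<lambda>_. undefined}" using True by (auto simp: space_random_bits)
  then have "\<Theta> = {} \<or> \<Theta> = space (random_bits V)" if "\<Theta> \<in> sets (random_bits V)" for \<Theta>
    using sets.sets_into_space[OF that] by auto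
  then have "\<Phi> = {} \<or> \<Phi> = space (random_bits V)" "\<Psi> = {} \<or> \<Psi> = space (random_bits V)"
    using \<Phi> \<Psi> by auto
  then show ?thesis by (auto simp: prob_space)
next
  case False
  interpret prob_space "random_bits V" by (rule prob_space_random_bits)
  have rv: "(\<lambda>\<omega>. \<omega> v) \<in> measurable (random_bits V) bit_streams" if "v \<in> V" for v
    using that by (simp add: random_bits_def measurable_component_singleton)
  have distr: "distr (random_bits V) bit_streams (\<lambda>\<omega>. \<omega> v) = bit_streams" if "v \<in> V" for v
    using distr_PiM_component[of V "\<lambda>_. bit_streams" v] prob_space_bit_streams that
    by (simp add: random_bits_def)
  have "indep_vars (\<lambda>_. bit_streams) (\<lambda>v \<omega>. \<omega> v) V"
  proof (subst indep_vars_iff_distr_eq_PiM')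
    have "distr (random_bits V) (random_bits V) (\<lambda>\<omega>. \<lambda>v\<in>V. \<omega> v)
        = distr (random_bits V) (random_bits V) (\<lambda>\<omega>. \<omega>)"
      by (rule distr_cong) (auto simp: space_random_bits extensional_restrict)
    moreover have "PiM V (\<lambda>i. distr (random_bits V) bit_streams (\<lambda>\<omega>. \<omega> i)) = random_bits V"
      unfolding random_bits_def[symmetric] using distr
      by (subst (2) random_bits_def) (intro PiM_cong, auto)
    ultimately show "distr (random_bits V) (PiM V (\<lambda>i. bit_streams)) (\<lambda>x. \<lambda>i\<in>V. x i)
        = PiM V (\<lambda>i. distr (random_bits V) bit_streams (\<lambda>x. x i))"
      by (simp add: random_bits_def distr_id)
  qed (use False rv in auto)
  then have indep: "indep_var (PiM X (\<lambda>_. bit_streams)) (\<lambda>\<omega>. \<lambda>v\<in>X. \<omega> v)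
      (PiM Y (\<lambda>_. bit_streams)) (\<lambda>\<omega>. \<lambda>v\<in>Y. \<omega> v)"
    using \<Phi>(2) \<Psi>(2) disj by (intro indep_var_restrict) (auto dest: determined_byD(1))
  have pre: "\<exists>E \<in> sets (random_bits Z). \<Theta> = (\<lambda>\<omega>. \<lambda>v\<in>Z. \<omega> v) -` E \<inter> space (random_bits V)"
    if \<Theta>: "\<Theta> \<in> sets (random_bits V)" "determined_by V Z \<Theta>" for \<Theta> Z
  proof (rule dependent_event_preimage[OF \<Theta>(1), of id Z])
    show "inj_on id Z" "id ` Z \<subseteq> V" using \<Theta>(2) by (auto dest: determined_byD(1))
  next
    fix E assume E: "E \<in> sets (random_bits Z)"
      and *: "\<And>W \<Psi> g. \<lbrakk>g ` Z \<subseteq> W; \<Psi> \<subseteq> space (random_bits W);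
      \<And>\<omega> \<omega>'. \<lbrakk>\<omega> \<in> space (random_bits V); \<omega>' \<in> space (random_bits W);
         \<And>k. k \<in> Z \<Longrightarrow> \<omega> (id k) = \<omega>' (g k)\<rbrakk> \<Longrightarrow> \<omega> \<in> \<Theta> \<longleftrightarrow> \<omega>' \<in> \<Psi>\<rbrakk>
      \<Longrightarrow> \<Psi> = (\<lambda>\<omega>. \<lambda>k\<in>Z. \<omega> (g k)) -` E \<inter> space (random_bits W)"
    have "\<Theta> = (\<lambda>\<omega>. \<lambda>v\<in>Z. \<omega> (id v)) -` E \<inter> space (random_bits V)"
      using \<Theta> sets.sets_into_space[OF \<Theta>(1)] by (intro * determined_byD(2)[OF \<Theta>(2)])
        (auto dest: determined_byD(1))
    then show ?thesis using E by auto
  qed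
  obtain E1 where E1: "E1 \<in> sets (random_bits X)"
      "\<Phi> = (\<lambda>\<omega>. \<lambda>v\<in>X. \<omega> v) -` E1 \<inter> space (random_bits V)"
    using pre[OF \<Phi>] by blast
  obtain E2 where E2: "E2 \<in> sets (random_bits Y)"
      "\<Psi> = (\<lambda>\<omega>. \<lambda>v\<in>Y. \<omega> v) -` E2 \<inter> space (random_bits V)"
    using pre[OF \<Psi>] by blast
  have "\<Phi> \<inter> \<Psi> = (\<lambda>\<omega>. (\<lambda>v\<in>X. \<omega> v, \<lambda>v\<in>Y. \<omega> v)) -` (E1 \<times> E2) \<inter> space (random_bits V)"
    using E1 E2 by auto
  then show ?thesis
    using indep_varD[OF indep, of E1 E2] E1 E2 by (simp add: random_bits_def)
qed

text \<open>If all steps up to \<open>card B\<close> were strict, each would add an element and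
  \<open>S (Suc (card B))\<close> would be larger than \<open>B\<close>.\<close>

lemma increasing_chain_stalls:
  fixes S :: "nat \<Rightarrow> 'b set"
  assumes mono: "\<And>k. S k \<subseteq> S (Suc k)" and sub: "\<And>k. S k \<subseteq> B" and fin: "finite B"
  shows "\<exists>k\<le>card B. S k = S (Suc k)"
proof (rule ccontr)
  assume "\<not> ?thesis"
  then have strict: "S k \<subset> S (Suc k)" if "k \<le> card B" for k using that mono by blast
  have "k \<le> card (S k)" if "k \<le> Suc (card B)" for k
    using that
  proof (induction k)
    case (Suc k)
    then have "card (S k) < card (S (Suc k))"
      using strict[of k] finite_subset[OF sub fin] by (intro psubset_card_mono) auto
    with Suc show ?case by simp
  qed simp
  then have "Suc (card B) \<le> card (S (Suc (card B)))" by simp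
  also have "\<dots> \<le> card B" using sub fin by (rule card_mono[rotated])
  finally show False by simp
qed

subsection \<open>The certificate obtained from a fast algorithm\<close>

text \<open>A single size and a single tree are fixed; only the identifiers vary. The depth
  \<open>4 * T + 3\<close> arises as follows: certificate roots lie at depth \<open>T + 1\<close>,
  their leaves \<open>2 * T + 1\<close> levels below, the leaves see \<open>T\<close> levels
  further, and one more level fixes the degrees there. The condition \<open>large\<close> makes the
  failure probability small against all thresholds used later.\<close>

locale fast_solver =
  fixes P :: "'a lcl_problem" and A :: "(random_input, 's, 'm, 'a) algorithm"
    and V :: "node set" and C :: "nat set" and T :: nat
  assumes lcl: "lcl P" and full: "full_tree (arity P) V"
    and top: "\<And>u. length u \<le> 4 * T + 3 \<Longrightarrow> u \<in> V \<longleftrightarrow> set u \<subseteq> {..<arity P}"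
    and C: "finite C" "card V \<le> card C"
    and measurable_output: "\<And>ids v. \<lbrakk>inj_on ids V; ids ` V \<subseteq> C; v \<in> V\<rbrakk> \<Longrightarrow>
      (\<lambda>\<omega>. final_output A V (random_input V ids \<omega>) v) \<in> measurable (random_bits V) (count_space UNIV)"
    and success: "\<And>ids. \<lbrakk>inj_on ids V; ids ` V \<subseteq> C\<rbrakk> \<Longrightarrow> measure (random_bits V)
      {\<omega> \<in> space (random_bits V). solved P A V (random_input V ids \<omega>)} \<ge> 1 - 1 / real (card V)"
    and fast: "\<And>ids v \<omega>. \<lbrakk>inj_on ids V; ids ` V \<subseteq> C; v \<in> V; \<omega> \<in> space (random_bits V)\<rbrakk> \<Longrightarrow>
      \<exists>t\<le>T. has_output A V (random_input V ids \<omega>) t v"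
    and large: "8 * (card (labels P) + 1)\<^sup>2 *
        (4 * card (complete_nodes (arity P) (4 * T + 3)) * (card (labels P) + 1)\<^sup>2) ^ (card (labels P) + 1)
      \<le> card V"
begin

section \<open>Outputs and their probabilities on the fixed tree\<close>

abbreviation \<delta> where "\<delta> \<equiv> arity P"
abbreviation M where "M \<equiv> card (labels P) + 1"
abbreviation N where "N \<equiv> card (complete_nodes \<delta> (4 * T + 3))"

definition valid_ids :: "(node \<Rightarrow> nat) \<Rightarrow> bool" where
  "valid_ids ids \<longleftrightarrow> inj_on ids V \<and> ids ` V \<subseteq> C"

definition out :: "(node \<Rightarrow> nat) \<Rightarrow> (node \<Rightarrow> bool stream) \<Rightarrow> node \<Rightarrow> 'a option" where
  "out ids \<omega> v = final_output A V (random_input V ids \<omega>) v"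

definition output_event :: "(node \<Rightarrow> nat) \<Rightarrow> node \<Rightarrow> 'a option \<Rightarrow> (node \<Rightarrow> bool stream) set" where
  "output_event ids v s = {\<omega> \<in> space (random_bits V). out ids \<omega> v = s}"

definition success_event :: "(node \<Rightarrow> nat) \<Rightarrow> (node \<Rightarrow> bool stream) set" where
  "success_event ids = {\<omega> \<in> space (random_bits V). solved P A V (random_input V ids \<omega>)}"

definition levels :: "nat \<Rightarrow> nat \<Rightarrow> node set" where
  "levels a b = {w. set w \<subseteq> {..<\<delta>} \<and> a \<le> length w \<and> length w \<le> b}"

sublocale prob_space "random_bits V" by (rule prob_space_random_bits)

lemma \<delta>_pos: "1 \<le> \<delta>" and finite_labels: "finite (labels P)"
  using lcl unfolding lcl_def by blast+

lemma finite_V: "finite V"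
  using full unfolding full_tree_def rooted_tree_def by blast

lemma levels_subset: "b \<le> 4 * T + 3 \<Longrightarrow> levels a b \<subseteq> complete_nodes \<delta> (4 * T + 3)"
  by (auto simp: levels_def complete_nodes_def)

lemma finite_levels [simp]: "finite (levels a b)"
  by (rule finite_subset[OF _ finite_complete_nodes[of \<delta> b]])
     (auto simp: levels_def complete_nodes_def)

lemma card_levels_le: "b \<le> 4 * T + 3 \<Longrightarrow> card (levels a b) \<le> N"
  by (intro card_mono levels_subset) auto

lemma N_pos: "1 \<le> N"
proof -
  have "[] \<in> complete_nodes \<delta> (4 * T + 3)" by (simp add: complete_nodes_def)
  then have "0 < N" by (subst card_gt_0_iff) auto
  then show ?thesis by simp
qed

lemma append_levels_in_V:
  assumes "set p \<subseteq> {..<\<delta>}" "length p + b \<le> 4 * T + 3" "w \<in> levels a b"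
  shows "p @ w \<in> V"
  using assms top[of "p @ w"] by (auto simp: levels_def)

lemma num_children_top:
  assumes "set v \<subseteq> {..<\<delta>}" "length v < 4 * T + 3"
  shows "num_children V v = \<delta>"
  using assms by (intro num_children_eqI) (auto simp: top)

text \<open>Within \<open>T\<close> rounds a node at relative depth \<open>T + 1\<close> only sees
  the relative levels 1 to \<open>2 * T + 1\<close>. All nodes there have a parent and
  \<open>\<delta>\<close> children, so apart from identifiers and bits their inputs agree.\<close>

lemma out_local:
  assumes ids: "valid_ids ids" "valid_ids ids'"
    and \<omega>: "\<omega> \<in> space (random_bits V)" "\<omega>' \<in> space (random_bits V)"
    and p: "set p \<subseteq> {..<\<delta>}" "length p \<le> 2 * T + 1"
    and p': "set p' \<subseteq> {..<\<delta>}" "length p' \<le> 2 * T + 1"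
    and q: "set q \<subseteq> {..<\<delta>}" "length q = T + 1"
    and eq: "\<And>w. w \<in> levels 1 (2 * T + 1) \<Longrightarrow> ids (p @ w) = ids' (p' @ w)"
      "\<And>w. w \<in> levels 1 (2 * T + 1) \<Longrightarrow> \<omega> (p @ w) = \<omega>' (p' @ w)"
  shows "out ids \<omega> (p @ q) = out ids' \<omega>' (p' @ q)"
  unfolding out_def
proof (rule final_output_eqI[where T = T])
  show "\<exists>t\<le>T. has_output A V (random_input V ids \<omega>) t (p @ q)"
    using ids(1) \<omega>(1) p q by (intro fast) (auto simp: valid_ids_def top)
  fix t assume t: "t \<le> T"
  have inp: "random_input V ids \<omega> (p @ w) = random_input V ids' \<omega>' (p' @ w)"
    if w: "set w \<subseteq> {..<\<delta>}" "1 \<le> length w" "length w \<le> 2 * T + 1" for w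
  proof -
    have "w \<in> levels 1 (2 * T + 1)" using w by (simp add: levels_def)
    moreover have "num_children V (p @ w) = \<delta>" "num_children V (p' @ w) = \<delta>"
      using w p p' by (auto intro!: num_children_top)
    moreover have "w \<noteq> []" using w by auto
    ultimately show ?thesis
      using eq by (simp add: random_input_def local_input_def deg_def)
  qed
  show "state A V (random_input V ids \<omega>) t (p @ q) = state A V (random_input V ids' \<omega>') t (p' @ q)"
    using p p' q t top inp by (intro state_local[where D = "4 * T + 3" and \<delta> = \<delta> and T = T]) auto
qed

lemma output_event_sets:
  assumes "valid_ids ids" "v \<in> V"
  shows "output_event ids v s \<in> sets (random_bits V)"
proof -
  have "output_event ids v s = (\<lambda>\<omega>. final_output A V (random_input V ids \<omega>) v) -` {s} \<inter> space (random_bits V)"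
    by (auto simp: output_event_def out_def)
  then show ?thesis
    using assms measurable_sets[OF measurable_output, of ids v "{s}"] by (simp add: valid_ids_def)
qed

text \<open>By locality a node can be moved, together with the identifiers around it, to depth
  \<open>T + 1\<close> without changing its output distribution.\<close>

lemma prob_output_event_shift:
  assumes ids: "valid_ids ids" "valid_ids ids'"
    and p: "set p \<subseteq> {..<\<delta>}" "length p \<le> 2 * T + 1"
    and q: "set q \<subseteq> {..<\<delta>}" "length q = T + 1"
    and eq: "\<And>w. w \<in> levels 1 (2 * T + 1) \<Longrightarrow> ids (p @ w) = ids' w"
  shows "prob (output_event ids (p @ q) s) = prob (output_event ids' q s)"
proof (rule random_bits_transfer)
  show "output_event ids (p @ q) s \<in> events" "output_event ids' q s \<in> events"
    using p q by (auto intro!: output_event_sets ids simp: top)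
  show "inj_on ((@) p) (levels 1 (2 * T + 1))" "inj_on (\<lambda>w. w) (levels 1 (2 * T + 1))"
    by (auto simp: inj_on_def)
  show "(@) p ` levels 1 (2 * T + 1) \<subseteq> V"
    using p by (intro image_subsetI append_levels_in_V[where a = 1 and b = "2 * T + 1"]) auto
  show "(\<lambda>w. w) ` levels 1 (2 * T + 1) \<subseteq> V"
    using append_levels_in_V[of "[]" "2 * T + 1"] by auto
  fix \<omega> \<omega>' assume *: "\<omega> \<in> space (random_bits V)" "\<omega>' \<in> space (random_bits V)"
    "\<And>w. w \<in> levels 1 (2 * T + 1) \<Longrightarrow> \<omega> (p @ w) = \<omega>' w"
  have "out ids \<omega> (p @ q) = out ids' \<omega>' ([] @ q)"
    using * p q eq by (intro out_local ids) auto
  then show "\<omega> \<in> output_event ids (p @ q) s \<longleftrightarrow> \<omega>' \<in> output_event ids' q s"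
    using * by (simp add: output_event_def)
qed

text \<open>Consequences of \<open>large\<close>: there are enough identifiers for the windows
  around the roots of all certificate trees and one further window around their leaves, runs succeed
  with probability at least 3/4, and failure is rare compared with the thresholds.\<close>

lemma M_N_bounds: "M * N + N \<le> card V" "4 \<le> card V"
  and card_V_ge: "8 * (real M)\<^sup>2 * (4 * real N * (real M)\<^sup>2) ^ M \<le> real (card V)"
proof -
  show "8 * (real M)\<^sup>2 * (4 * real N * (real M)\<^sup>2) ^ M \<le> real (card V)"
    using of_nat_mono[OF large, where 'a = real] by simp
  have N: "1 \<le> N" by (rule N_pos)
  have M: "M \<le> M\<^sup>2" "1 \<le> M\<^sup>2" by (simp_all add: power2_eq_square)
  have "4 * N * M\<^sup>2 \<le> (4 * N * M\<^sup>2) ^ M"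
    using N by (intro self_le_power) auto
  then have "8 * M\<^sup>2 * (4 * N * M\<^sup>2) \<le> card V"
    using large by (meson le_trans mult_le_mono2)
  moreover have "4 * N * M\<^sup>2 \<le> 8 * M\<^sup>2 * (4 * N * M\<^sup>2)"
    using mult_le_mono1[of 1 "8 * M\<^sup>2" "4 * N * M\<^sup>2"] M(2) by linarith
  ultimately have *: "4 * N * M\<^sup>2 \<le> card V" by linarith
  have "M * N + 1 * N \<le> M\<^sup>2 * N + M\<^sup>2 * N" "4 * 1 * 1 \<le> 4 * N * M\<^sup>2"
    by (intro add_mono mult_le_mono M N le_refl)+
  then show "M * N + N \<le> card V" "4 \<le> card V" using * by (auto simp: algebra_simps)
qed

lemma prob_success:
  assumes "valid_ids ids"
  shows "prob (success_event ids) \<ge> 1 - 1 / real (card V)" "success_event ids \<in> events"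
proof -
  show *: "prob (success_event ids) \<ge> 1 - 1 / real (card V)"
    using assms success unfolding success_event_def valid_ids_def by blast
  \<comment> \<open>Sets outside the sigma-algebra have measure 0, so a nonzero value shows that the
    success event is measurable.\<close>
  have "1 / real (card V) < 1" using M_N_bounds(2) by simp
  with * have "prob (success_event ids) \<noteq> 0" by linarith
  then show "success_event ids \<in> events" using measure_notin_sets by blast
qed

lemma success_eventD:
  assumes "\<omega> \<in> success_event ids"
  shows "\<omega> \<in> space (random_bits V)" "v \<in> V \<Longrightarrow> out ids \<omega> v \<in> Some ` labels P"
    "correct P V (\<lambda>v. the (out ids \<omega> v))"
proof -
  show "\<omega> \<in> space (random_bits V)" "correct P V (\<lambda>v. the (out ids \<omega> v))"
    using assms by (auto simp: success_event_def solved_def out_def)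
  moreover have "out ids \<omega> v \<noteq> None" if "v \<in> V"
    using assms that by (auto simp: success_event_def solved_def out_def)
  ultimately show "out ids \<omega> v \<in> Some ` labels P" if "v \<in> V"
    using that unfolding correct_def by (metis imageI image_subset_iff option.collapse)
qed

section \<open>Likely labels and the choice of the threshold\<close>

text \<open>
  The ratio of successive thresholds is such that in one run it is still unlikely, compared with
  \<open>threshold k\<close>, that any of the \<open>N\<close> nodes outputs any of the labels below \<open>threshold (Suc k)\<close>.
\<close>

definition threshold :: "nat \<Rightarrow> real" where
  "threshold k = (1 / (4 * real N * (real M)\<^sup>2)) ^ k / (2 * real M)"

text \<open>Considering nodes at depth \<open>T + 1\<close> suffices, since by
  \<open>prob_output_event_shift\<close> they represent all nodes at depths \<open>T + 1\<close> to
  \<open>3 * T + 2\<close>.\<close>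

definition likely :: "nat \<Rightarrow> 'a set" where
  "likely k = {s \<in> labels P. \<exists>q ids. set q \<subseteq> {..<\<delta>} \<and> length q = T + 1 \<and> valid_ids ids \<and>
     threshold k \<le> prob (output_event ids q (Some s))}"

lemma threshold_pos: "0 < threshold k"
  using N_pos by (auto simp: threshold_def)

text \<open>The left-hand side is the cost of a union bound over \<open>N\<close> nodes and
  \<open>M\<close> labels.\<close>

lemma threshold_Suc: "real N * real M * threshold (Suc k) = threshold k / (4 * real M)"
proof -
  have *: "n * m * ((1 / (4 * n * m\<^sup>2)) ^ Suc k / (2 * m)) = (1 / (4 * n * m\<^sup>2)) ^ k / (2 * m) / (4 * m)"
    if "n \<noteq> 0" "m \<noteq> 0" for n m :: real
    using that by (simp add: power2_eq_square)
  have "real N \<noteq> 0" "real M \<noteq> 0" using N_pos by linarith+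
  from *[OF this] show ?thesis unfolding threshold_def .
qed

lemma threshold_antimono: "k \<le> l \<Longrightarrow> threshold l \<le> threshold k"
proof -
  have "1 * 1 \<le> real N * (real M)\<^sup>2" using N_pos by (intro mult_mono) auto
  then show "k \<le> l \<Longrightarrow> threshold l \<le> threshold k"
    unfolding threshold_def by (intro divide_right_mono power_decreasing) (auto simp: field_simps)
qed

lemma ex_valid_ids_extend:
  assumes "X \<subseteq> V" "inj_on f X" "f ` X \<subseteq> C"
  shows "\<exists>ids. valid_ids ids \<and> (\<forall>x\<in>X. ids x = f x)"
  using inj_on_extend[OF C(1) finite_V assms C(2)] unfolding valid_ids_def by blast

text \<open>Copying the identifiers around \<open>p @ q\<close> to the top of the tree gives node
  \<open>q\<close> the same output distribution, and there the definition of \<open>likely\<close>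
  applies.\<close>

lemma unlikely_output:
  assumes ids: "valid_ids ids" and p: "set p \<subseteq> {..<\<delta>}" "length p \<le> 2 * T + 1"
    and q: "set q \<subseteq> {..<\<delta>}" "length q = T + 1" and s: "s \<in> labels P - likely k"
  shows "prob (output_event ids (p @ q) (Some s)) < threshold k"
proof -
  let ?X = "levels 1 (2 * T + 1)"
  have inV: "p @ w \<in> V" if "w \<in> ?X" for w
    using p that by (intro append_levels_in_V[where a = 1 and b = "2 * T + 1"]) auto
  have "\<exists>ids'. valid_ids ids' \<and> (\<forall>w\<in>?X. ids' w = ids (p @ w))"
  proof (rule ex_valid_ids_extend)
    show "?X \<subseteq> V" using append_levels_in_V[of "[]" "2 * T + 1"] by auto
    show "inj_on (\<lambda>w. ids (p @ w)) ?X"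
      using ids inV by (auto simp: valid_ids_def inj_on_def)
    show "(\<lambda>w. ids (p @ w)) ` ?X \<subseteq> C" using ids inV by (auto simp: valid_ids_def)
  qed
  then obtain ids' where ids': "valid_ids ids'" "\<And>w. w \<in> ?X \<Longrightarrow> ids (p @ w) = ids' w" by auto
  then have "prob (output_event ids (p @ q) (Some s)) = prob (output_event ids' q (Some s))"
    using ids p q by (intro prob_output_event_shift) auto
  also have "\<dots> < threshold k" using s q ids' unfolding likely_def by force
  finally show ?thesis .
qed

text \<open>As \<open>threshold 0\<close> is \<open>1 / (2 * M)\<close>, a node all of whose labels
  stay below it outputs a label with probability at most 1/2, whereas runs succeed with probability
  at least 3/4.\<close>

lemma likely_nonempty: "likely 0 \<noteq> {}"
proof
  assume empty: "likely 0 = {}"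
  obtain ids where ids: "valid_ids ids" using ex_valid_ids_extend[of "{}"] by auto
  let ?q = "replicate (T + 1) 0"
  have q: "set ?q \<subseteq> {..<\<delta>}" "length ?q = T + 1" "?q \<in> V" using \<delta>_pos top[of ?q] by auto
  have "1 - 1 / real (card V) \<le> prob (success_event ids)" by (rule prob_success[OF ids])
  also have "\<dots> \<le> prob (\<Union>s\<in>labels P. output_event ids ?q (Some s))"
  proof (rule finite_measure_mono)
    show "success_event ids \<subseteq> (\<Union>s\<in>labels P. output_event ids ?q (Some s))"
    proof
      fix \<omega> assume "\<omega> \<in> success_event ids"
      from success_eventD(1)[OF this] success_eventD(2)[OF this q(3)]
      show "\<omega> \<in> (\<Union>s\<in>labels P. output_event ids ?q (Some s))"
        unfolding output_event_def by auto
    qed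
    show "(\<Union>s\<in>labels P. output_event ids ?q (Some s)) \<in> events"
      using finite_labels ids q by (intro sets.finite_UN output_event_sets) auto
  qed
  also have "\<dots> \<le> (\<Sum>s\<in>labels P. prob (output_event ids ?q (Some s)))"
    using finite_labels ids q by (intro measure_UNION_le output_event_sets) auto
  also have "\<dots> \<le> (\<Sum>s\<in>labels P. threshold 0)"
    using empty ids q unlikely_output[of ids "[]" ?q _ 0] by (intro sum_mono) force
  also have "\<dots> \<le> 1 / 2" by (simp add: threshold_def field_simps)
  finally have "1 / 2 \<le> 1 / real (card V)" by linarith
  then show False using M_N_bounds(2) by (simp add: field_simps)
qed

text \<open>The thresholds decrease, so the sets \<open>likely k\<close> increase inside the finite
  label set. At a stable \<open>k\<close> no label has its largest output probability between
  \<open>threshold (Suc k)\<close> and \<open>threshold k\<close>.\<close>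

lemma ex_stable_threshold:
  obtains k where "k < M" "likely k \<noteq> {}" "likely (Suc k) = likely k"
proof -
  have mono: "likely k \<subseteq> likely (Suc k)" for k
    using threshold_antimono[of k "Suc k"] unfolding likely_def by force
  have "\<exists>k\<le>card (labels P). likely k = likely (Suc k)"
    using mono finite_labels by (intro increasing_chain_stalls) (auto simp: likely_def)
  then obtain k where "k < M" "likely (Suc k) = likely k" by (metis add.commute le_imp_less_Suc plus_1_eq_Suc)
  moreover have "likely 0 \<subseteq> likely k" using lift_Suc_mono_le[of likely 0 k] mono by auto
  ultimately show ?thesis using that likely_nonempty by blast
qed


section \<open>Construction of the certificate\<close>

lemma certificate: "has_logstar_certificate P"
proof -
  obtain k where k: "k < M" "likely k \<noteq> {}" "likely (Suc k) = likely k"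
    by (rule ex_stable_threshold)
  define S where "S = likely k"
  have S: "S \<subseteq> labels P" "finite S" "card S \<le> M"
    using finite_labels finite_subset card_mono[OF finite_labels, of S]
    by (auto simp: S_def likely_def)
  have "\<forall>s\<in>S. \<exists>q ids. set q \<subseteq> {..<\<delta>} \<and> length q = T + 1 \<and> valid_ids ids \<and>
      threshold k \<le> prob (output_event ids q (Some s))"
    unfolding S_def likely_def by blast
  then obtain root ids0 where
    root: "\<And>s. s \<in> S \<Longrightarrow> set (root s) \<subseteq> {..<\<delta>}" "\<And>s. s \<in> S \<Longrightarrow> length (root s) = T + 1"
    and ids0: "\<And>s. s \<in> S \<Longrightarrow> valid_ids (ids0 s)"
      "\<And>s. s \<in> S \<Longrightarrow> threshold k \<le> prob (output_event (ids0 s) (root s) (Some s))"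
    by metis
  \<comment> \<open>\<open>W\<close> contains all that influences the output at
    \<open>root s\<close>, and \<open>L\<close>, relative to \<open>root s\<close>, all that
    influences the leaves at relative level \<open>2 * T + 1\<close>. The second window starts at
    depth \<open>2 * T + 2\<close>, just below the first.\<close>
  define W where "W = levels 1 (2 * T + 1)"
  define L where "L = levels (T + 1) (3 * T + 1)"
  \<comment> \<open>the identifiers that the leaf levels must avoid, so that they can be shared by all \<open>s\<close>\<close>
  define J where "J = (\<Union>s\<in>S. ids0 s ` W)"
  have W_V: "W \<subseteq> V" using append_levels_in_V[of "[]" "2 * T + 1" _ 1] by (auto simp: W_def)
  have L_V: "root s @ z \<in> V" if "s \<in> S" "z \<in> L" for s z
    using root that unfolding L_def
    by (intro append_levels_in_V[where a = "T + 1" and b = "3 * T + 1"]) auto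
  have disj: "W \<inter> (@) (root s) ` L = {}" if "s \<in> S" for s
    using root(2)[OF that] by (auto simp: W_def L_def levels_def)
  have "card J \<le> (\<Sum>s\<in>S. card (ids0 s ` W))"
    unfolding J_def by (rule card_UN_le[OF S(2)])
  also have "\<dots> \<le> (\<Sum>s\<in>S. N)"
    using card_levels_le[of "2 * T + 1" 1]
    by (intro sum_mono order.trans[OF card_image_le]) (auto simp: W_def)
  also have "\<dots> \<le> M * N" using mult_le_mono1[OF S(3), of N] by (simp only: sum_constant) simp
  finally have "card J \<le> M * N" .
  then have "card L + card J \<le> card C"
    using card_levels_le[of "3 * T + 1" "T + 1"] M_N_bounds(1) C(2) by (simp add: L_def)
  moreover have "card C - card J \<le> card (C - J)"
    using S(2) by (intro diff_card_le_card_Diff) (auto simp: J_def W_def)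
  ultimately have "card L \<le> card (C - J)" by linarith
  then obtain c where c: "inj_on c L" "c ` L \<subseteq> C - J"
    using card_le_inj[of L "C - J"] C(1) unfolding L_def by auto
  have "\<exists>ids. valid_ids ids \<and> (\<forall>w\<in>W. ids w = ids0 s w) \<and> (\<forall>z\<in>L. ids (root s @ z) = c z)"
    if s: "s \<in> S" for s
  proof -
    \<comment> \<open>Dropping \<open>T + 1\<close> entries recovers \<open>z\<close> from
      \<open>root s @ z\<close>.\<close>
    define f where "f x = (if x \<in> W then ids0 s x else c (drop (T + 1) x))" for x
    have f_L: "f (root s @ z) = c z" if "z \<in> L" for z
      using that disj[OF s] root(2)[OF s] by (auto simp: f_def)
    have f_W: "f w = ids0 s w" if "w \<in> W" for w using that by (simp add: f_def)
    let ?X = "W \<union> (@) (root s) ` L"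
    have "inj_on f ?X"
      unfolding inj_on_Un
    proof (intro conjI)
      have "inj_on (ids0 s) W" using ids0(1)[OF s] W_V inj_on_subset unfolding valid_ids_def by blast
      then show "inj_on f W" using f_W inj_on_cong[of W f "ids0 s"] by blast
      show "inj_on f ((@) (root s) ` L)" using c(1) f_L by (auto simp: inj_on_def)
      have "f ` W \<subseteq> J" using s f_W by (auto simp: J_def)
      moreover have "f ` (@) (root s) ` L \<subseteq> C - J" using f_L c(2) by auto
      ultimately show "f ` (W - (@) (root s) ` L) \<inter> f ` ((@) (root s) ` L - W) = {}" by blast
    qed
    moreover have "f ` W \<subseteq> C" using ids0(1)[OF s] W_V f_W by (force simp: valid_ids_def)
    then have "f ` ?X \<subseteq> C" using f_L c(2) by auto
    ultimately have "\<exists>ids. valid_ids ids \<and> (\<forall>x\<in>?X. ids x = f x)"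
      using W_V L_V[OF s] by (intro ex_valid_ids_extend) auto
    then show ?thesis using f_L f_W by (metis (no_types, lifting) UnI1 UnI2 imageI)
  qed
  then obtain ids where ids: "\<And>s. s \<in> S \<Longrightarrow> valid_ids (ids s)"
      "\<And>s w. s \<in> S \<Longrightarrow> w \<in> W \<Longrightarrow> ids s w = ids0 s w"
      "\<And>s z. s \<in> S \<Longrightarrow> z \<in> L \<Longrightarrow> ids s (root s @ z) = c z"
    by metis

  define Z where "Z = complete_nodes \<delta> (2 * T + 1)"
  define \<Lambda> where "\<Lambda> = {z \<in> Z. length z = 2 * T + 1}"
  have fin_\<Lambda>: "finite \<Lambda>" by (simp add: \<Lambda>_def Z_def)
  have Z_V: "root s @ z \<in> V" if "s \<in> S" "z \<in> Z" for s z
    using root that by (subst top) (auto simp: Z_def complete_nodes_def)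
  define leaf_labels where "leaf_labels s \<omega> = (\<lambda>z\<in>\<Lambda>. out (ids s) \<omega> (root s @ z))" for s \<omega>
  define good where "good s \<omega> \<longleftrightarrow> \<omega> \<in> success_event (ids s) \<and>
      (\<forall>z\<in>Z. out (ids s) \<omega> (root s @ z) \<in> Some ` S)" for s \<omega>
  \<comment> \<open>Bad for \<open>s\<close> are the leaf labelings that no good run with output
    \<open>s\<close> at \<open>root s\<close> produces. In \<open>bad_event t s\<close> the labeling
    is produced below \<open>root t\<close> but judged with respect to \<open>s\<close>, so that one
    run can be tested against all \<open>s\<close>.\<close>
  define bad where "bad s = {l \<in> \<Lambda> \<rightarrow>\<^sub>E Some ` labels P.
      \<nexists>\<omega>. good s \<omega> \<and> out (ids s) \<omega> (root s) = Some s \<and> leaf_labels s \<omega> = l}" for s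
  define bad_event where
    "bad_event t s = {\<omega> \<in> space (random_bits V). leaf_labels t \<omega> \<in> bad s}" for s t

  have leaf_local: "leaf_labels s \<omega> = leaf_labels t \<omega>'"
    if st: "s \<in> S" "t \<in> S" and sp: "\<omega> \<in> space (random_bits V)" "\<omega>' \<in> space (random_bits V)"
      and agree: "\<And>z. z \<in> L \<Longrightarrow> \<omega> (root s @ z) = \<omega>' (root t @ z)" for s t \<omega> \<omega>'
  proof -
    have "out (ids s) \<omega> (root s @ z) = out (ids t) \<omega>' (root t @ z)" if z: "z \<in> \<Lambda>" for z
    proof -
      have z': "set z \<subseteq> {..<\<delta>}" "length z = 2 * T + 1"
        using z by (auto simp: \<Lambda>_def Z_def complete_nodes_def)
      have sub: "set (take T z) \<subseteq> {..<\<delta>}" "set (drop T z) \<subseteq> {..<\<delta>}"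
        using z'(1) set_take_subset set_drop_subset by (metis order.trans)+
      have inL: "take T z @ w \<in> L" if "w \<in> levels 1 (2 * T + 1)" for w
        using that z' sub by (auto simp: L_def levels_def)
      \<comment> \<open>The leaf is viewed from its ancestor \<open>T + 1\<close> levels above, at
        relative level \<open>T\<close>; the window of that ancestor is contained in
        \<open>L\<close>.\<close>
      have "out (ids s) \<omega> ((root s @ take T z) @ drop T z) = out (ids t) \<omega>' ((root t @ take T z) @ drop T z)"
        using st sp agree root ids z' sub inL by (intro out_local) auto
      then show ?thesis by simp
    qed
    then show ?thesis by (auto simp: leaf_labels_def intro!: restrict_ext)
  qed
  have bad_sets: "bad_event t s \<in> events" if "t \<in> S" for s t
  proof -
    have leaf_iff: "leaf_labels t \<omega> = l \<longleftrightarrow> (\<forall>z\<in>\<Lambda>. out (ids t) \<omega> (root t @ z) = l z)"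
      if "l \<in> bad s" for l \<omega>
      using that by (auto simp: leaf_labels_def bad_def fun_eq_iff PiE_def extensional_def)
    have "bad_event t s = (\<Union>l\<in>bad s. {\<omega> \<in> space (random_bits V). leaf_labels t \<omega> = l})"
      by (auto simp: bad_event_def)
    also have "\<dots> = (\<Union>l\<in>bad s. {\<omega> \<in> space (random_bits V). \<forall>z\<in>\<Lambda>. out (ids t) \<omega> (root t @ z) = l z})"
      using leaf_iff by blast
    also have "\<dots> \<in> events"
    proof (intro sets.finite_UN sets.sets_Collect_finite_All')
      show "finite (bad s)"
        using finite_labels fin_\<Lambda> unfolding bad_def
        by (intro finite_subset[OF _ finite_PiE[of \<Lambda> "\<lambda>_. Some ` labels P"]]) auto
      fix l z assume "z \<in> \<Lambda>"
      then have "output_event (ids t) (root t @ z) (l z) \<in> events"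
        using \<open>t \<in> S\<close> by (intro output_event_sets ids Z_V) (auto simp: \<Lambda>_def)
      then show "{\<omega> \<in> space (random_bits V). out (ids t) \<omega> (root t @ z) = l z} \<in> events"
        by (simp add: output_event_def)
    next
      have "replicate (2 * T + 1) 0 \<in> \<Lambda>" using \<delta>_pos by (auto simp: \<Lambda>_def Z_def complete_nodes_def)
      then show "\<Lambda> \<noteq> {}" by blast
    qed (rule fin_\<Lambda>)
    finally show ?thesis .
  qed
  \<comment> \<open>All leaf windows carry the identifiers \<open>c\<close>, so the leaf labels have
    the same distribution below every root.\<close>
  have bad_eq: "prob (bad_event t s) = prob (bad_event s s)" if "s \<in> S" "t \<in> S" for s t
  proof (rule random_bits_transfer)
    show "bad_event t s \<in> events" "bad_event s s \<in> events" using bad_sets that by auto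
    show "inj_on ((@) (root t)) L" "inj_on ((@) (root s)) L" by (auto simp: inj_on_def)
    show "(@) (root t) ` L \<subseteq> V" "(@) (root s) ` L \<subseteq> V" using L_V that by auto
    fix \<omega> \<omega>' assume "\<omega> \<in> space (random_bits V)" "\<omega>' \<in> space (random_bits V)"
      "\<And>z. z \<in> L \<Longrightarrow> \<omega> (root t @ z) = \<omega>' (root s @ z)"
    then show "\<omega> \<in> bad_event t s \<longleftrightarrow> \<omega>' \<in> bad_event s s"
      using leaf_local[of t s \<omega> \<omega>'] that by (simp add: bad_event_def)
  qed
  have root_V: "root s \<in> V" if "s \<in> S" for s using Z_V[OF that, of "[]"] by (simp add: Z_def complete_nodes_def)
  have indep: "prob (bad_event s s \<inter> output_event (ids s) (root s) (Some s))
      = prob (bad_event s s) * prob (output_event (ids s) (root s) (Some s))" if s: "s \<in> S" for s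
  proof (rule random_bits_indep)
    show "determined_by V ((@) (root s) ` L) (bad_event s s)"
      unfolding determined_by_def
    proof (intro conjI ballI impI)
      show "(@) (root s) ` L \<subseteq> V" using L_V s by auto
      fix \<omega> \<omega>' assume "\<omega> \<in> space (random_bits V)" "\<omega>' \<in> space (random_bits V)"
        "\<forall>v\<in>(@) (root s) ` L. \<omega> v = \<omega>' v"
      then show "\<omega> \<in> bad_event s s \<longleftrightarrow> \<omega>' \<in> bad_event s s"
        using leaf_local[of s s \<omega> \<omega>'] s by (simp add: bad_event_def)
    qed
    show "determined_by V W (output_event (ids s) (root s) (Some s))"
      unfolding determined_by_def
    proof (intro conjI ballI impI)
      fix \<omega> \<omega>' assume "\<omega> \<in> space (random_bits V)" "\<omega>' \<in> space (random_bits V)" "\<forall>v\<in>W. \<omega> v = \<omega>' v"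
      moreover from this have "out (ids s) \<omega> ([] @ root s) = out (ids s) \<omega>' ([] @ root s)"
        using root s ids by (intro out_local) (auto simp: W_def)
      ultimately show "\<omega> \<in> output_event (ids s) (root s) (Some s) \<longleftrightarrow>
          \<omega>' \<in> output_event (ids s) (root s) (Some s)" by (simp add: output_event_def)
    qed (rule W_V)
    show "(@) (root s) ` L \<inter> W = {}" using disj[OF s] by blast
  qed (use s bad_sets output_event_sets ids root_V in auto)
  \<comment> \<open>\<open>ids s\<close> differs from \<open>ids0 s\<close> only outside
    \<open>W\<close>, where the output at \<open>root s\<close> is not affected.\<close>
  have root_prob: "threshold k \<le> prob (output_event (ids s) (root s) (Some s))" if s: "s \<in> S" for s
  proof -
    have "prob (output_event (ids s) ([] @ root s) (Some s)) = prob (output_event (ids0 s) (root s) (Some s))"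
      using root s ids ids0 by (intro prob_output_event_shift) (auto simp: W_def)
    then show ?thesis using ids0(2)[OF s] by simp
  qed
  define fail where "fail s = (space (random_bits V) - success_event (ids s)) \<union>
      (\<Union>(z, y)\<in>Z \<times> (labels P - S). output_event (ids s) (root s @ z) (Some y))" for s
  have fail_sets: "fail s \<in> events" if "s \<in> S" for s
    unfolding fail_def using that finite_labels ids prob_success(2) Z_V
    by (auto intro!: sets.finite_UN output_event_sets simp: Z_def)
  have fail_prob: "prob (fail s) \<le> 1 / real (card V) + threshold k / (4 * real M)" if s: "s \<in> S" for s
  proof -
    let ?U = "\<Union>(z, y)\<in>Z \<times> (labels P - S). output_event (ids s) (root s @ z) (Some y)"
    have ev: "output_event (ids s) (root s @ z) (Some y) \<in> events" if "z \<in> Z" for z y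
      using that s by (intro output_event_sets ids Z_V)
    have small: "prob (output_event (ids s) (root s @ z) (Some y)) \<le> threshold (Suc k)"
      if z: "z \<in> Z" and y: "y \<in> labels P - S" for z y
    proof -
      \<comment> \<open>Every node of the tree below \<open>root s\<close> is split at its ancestor
        \<open>T + 1\<close> levels above, which has depth \<open>length z\<close>.\<close>
      let ?u = "root s @ z" let ?p = "take (length z) ?u" let ?q = "drop (length z) ?u"
      have u: "set ?u \<subseteq> {..<\<delta>}" "length z \<le> 2 * T + 1"
        using z root s by (auto simp: Z_def complete_nodes_def)
      have sub: "set ?p \<subseteq> {..<\<delta>}" "set ?q \<subseteq> {..<\<delta>}"
        using u(1) set_take_subset set_drop_subset by (metis order.trans)+
      have "prob (output_event (ids s) (?p @ ?q) (Some y)) < threshold (Suc k)"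
      proof (rule unlikely_output)
        \<comment> \<open>Stability of \<open>k\<close> enters here: a label outside
          \<open>S\<close> is even below the next, much smaller threshold.\<close>
        show "y \<in> labels P - likely (Suc k)" using y k(3) by (simp add: S_def)
      qed (use sub u root s ids in auto)
      then show ?thesis by (simp only: append_take_drop_id)
    qed
    have "prob (fail s) \<le> prob (space (random_bits V) - success_event (ids s)) + prob ?U"
      unfolding fail_def using s ids prob_success(2) ev finite_labels
      by (intro measure_Un_le) (auto intro!: sets.finite_UN simp: Z_def)
    moreover have "prob (space (random_bits V) - success_event (ids s)) \<le> 1 / real (card V)"
      using prob_success[OF ids(1)[OF s]] by (simp add: prob_compl)
    moreover have "prob ?U \<le> threshold k / (4 * real M)"
    proof -
      have "prob ?U \<le> (\<Sum>(z, y)\<in>Z \<times> (labels P - S). prob (output_event (ids s) (root s @ z) (Some y)))"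
        using finite_labels ev
        by (intro order.trans[OF measure_UNION_le]) (auto simp: Z_def split_def)
      also have "\<dots> \<le> (\<Sum>(z, y)\<in>Z \<times> (labels P - S). threshold (Suc k))"
        using small by (intro sum_mono) auto
      also have "\<dots> = real (card Z) * real (card (labels P - S)) * threshold (Suc k)"
        by (simp add: card_cartesian_product split_def)
      also have "\<dots> \<le> real N * real M * threshold (Suc k)"
      proof (intro mult_right_mono mult_mono)
        show "real (card Z) \<le> real N"
          unfolding Z_def
          by (intro of_nat_mono card_mono finite_complete_nodes) (auto simp: complete_nodes_def)
        have "card (labels P - S) \<le> card (labels P)" using finite_labels by (intro card_mono) auto
        then show "real (card (labels P - S)) \<le> real M" by linarith
      qed (use threshold_pos[of "Suc k"] in auto)
      finally show ?thesis by (simp only: threshold_Suc)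
    qed
    ultimately show ?thesis by linarith
  qed
  \<comment> \<open>If nothing fails, the run itself is good and realizes its leaf labeling together
    with \<open>s\<close>, so the labeling is not bad for \<open>s\<close>.\<close>
  have cover: "bad_event s s \<inter> output_event (ids s) (root s) (Some s) \<subseteq> fail s" if s: "s \<in> S" for s
  proof (rule subsetI, rule ccontr)
    fix \<omega> assume \<omega>: "\<omega> \<in> bad_event s s \<inter> output_event (ids s) (root s) (Some s)" "\<omega> \<notin> fail s"
    then have sp: "\<omega> \<in> space (random_bits V)" and succ: "\<omega> \<in> success_event (ids s)"
      by (auto simp: fail_def bad_event_def)
    have "out (ids s) \<omega> (root s @ z) \<in> Some ` S" if z: "z \<in> Z" for z
    proof -
      obtain y where y: "y \<in> labels P" "out (ids s) \<omega> (root s @ z) = Some y"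
        using success_eventD(2)[OF succ Z_V[OF s z]] by blast
      then have "y \<in> S" using \<omega>(2) z sp by (auto simp: fail_def output_event_def)
      with y show ?thesis by simp
    qed
    then have "good s \<omega>" using succ by (simp add: good_def)
    then have "leaf_labels s \<omega> \<notin> bad s" using \<omega>(1) by (auto simp: bad_def output_event_def)
    with \<omega>(1) show False by (simp add: bad_event_def)
  qed
  \<comment> \<open>By independence and \<open>cover\<close>, the probability of
    \<open>bad_event s s\<close> times \<open>threshold k\<close> is at most that of
    \<open>fail s\<close>, which is at most \<open>threshold k / (2 * M)\<close>. Cancelling the
    threshold gives the bound, and \<open>bad_eq\<close> carries it over to
    \<open>t\<close>.\<close>
  have bad_prob: "prob (bad_event t s) \<le> 1 / (2 * real M)" if "s \<in> S" "t \<in> S" for s t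
  proof -
    have "prob (bad_event s s) * threshold k
        \<le> prob (bad_event s s) * prob (output_event (ids s) (root s) (Some s))"
      using root_prob[OF that(1)] by (intro mult_left_mono) auto
    also have "\<dots> \<le> prob (fail s)"
      unfolding indep[OF that(1), symmetric]
      using cover fail_sets that by (intro finite_measure_mono) auto
    also have "\<dots> \<le> 1 / real (card V) + threshold k / (4 * real M)" by (rule fail_prob[OF that(1)])
    also have "1 / real (card V) \<le> threshold k / (4 * real M)"
    proof -
      have pos: "0 < real N" "0 < real M" "0 < real (card V)"
        using N_pos M_N_bounds(2) by linarith+
      have "r / (2 * m) / (4 * m) = 1 / (8 * (m * m) * x)" if "r = 1 / x" for r m x :: real
        using that by simp
      note this[OF power_one_over, of "4 * real N * (real M)\<^sup>2" M "real M"]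
      then have "threshold M / (4 * real M) = 1 / (8 * (real M)\<^sup>2 * (4 * real N * (real M)\<^sup>2) ^ M)"
        unfolding threshold_def power2_eq_square .
      moreover have "1 / real (card V) \<le> 1 / (8 * (real M)\<^sup>2 * (4 * real N * (real M)\<^sup>2) ^ M)"
        by (intro divide_left_mono card_V_ge mult_pos_pos zero_less_power pos zero_less_numeral zero_le_one)
      moreover have "threshold M / (4 * real M) \<le> threshold k / (4 * real M)"
        using threshold_antimono[of k M] k(1) by (intro divide_right_mono) auto
      ultimately show ?thesis by linarith
    qed
    finally have "prob (bad_event s s) * threshold k \<le> threshold k / (4 * real M) + threshold k / (4 * real M)"
      by simp
    moreover have "x / (4 * m) + x / (4 * m) = 1 / (2 * m) * x" for x m :: real
      by (simp add: field_simps)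
    ultimately have "prob (bad_event s s) * threshold k \<le> 1 / (2 * real M) * threshold k"
      by (simp only:)
    then show ?thesis using threshold_pos[of k] bad_eq[OF that] by (simp only: mult_le_cancel_right_pos)
  qed
  obtain t where t: "t \<in> S" using k(2) by (auto simp: S_def)
  \<comment> \<open>The bad events together have probability at most 1/2, less than that of success;
    so some successful run has a leaf labeling that is bad for no \<open>s\<close>.\<close>
  have "prob (\<Union>s\<in>S. bad_event t s) \<le> (\<Sum>s\<in>S. prob (bad_event t s))"
    using S(2) bad_sets t by (intro measure_UNION_le) auto
  also have "\<dots> \<le> (\<Sum>s\<in>S. 1 / (2 * real M))" using bad_prob t by (intro sum_mono) auto
  also have "\<dots> \<le> real M * (1 / (2 * real M))"
    using S(3) by (simp only: sum_constant) (intro mult_right_mono of_nat_mono, auto)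
  also have "\<dots> = 1 / 2" by simp
  finally have "prob (\<Union>s\<in>S. bad_event t s) \<le> 1 / 2" .
  moreover have "1 / real (card V) \<le> 1 / 4" using M_N_bounds(2) by (intro divide_left_mono) auto
  ultimately have "prob (\<Union>s\<in>S. bad_event t s) < prob (success_event (ids t))"
    using prob_success(1)[OF ids(1)[OF t]] by linarith
  moreover have "(\<Union>s\<in>S. bad_event t s) \<in> events" using S(2) bad_sets[OF t] by blast
  ultimately have "\<not> success_event (ids t) \<subseteq> (\<Union>s\<in>S. bad_event t s)"
    using finite_measure_mono[of "success_event (ids t)" "\<Union>s\<in>S. bad_event t s"] by linarith
  then obtain \<omega>0 where \<omega>0: "\<omega>0 \<in> success_event (ids t)" "\<And>s. s \<in> S \<Longrightarrow> \<omega>0 \<notin> bad_event t s"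
    by auto
  have "leaf_labels t \<omega>0 \<in> \<Lambda> \<rightarrow>\<^sub>E Some ` labels P"
    using success_eventD(2)[OF \<omega>0(1)] Z_V[OF t] by (auto simp: leaf_labels_def \<Lambda>_def)
  \<comment> \<open>The run \<open>\<omega>0\<close> only supplies the common leaf labeling and need
    not be good. Each \<open>s\<close> gets a good run of its own with these leaves and root label
    \<open>s\<close>.\<close>
  then have "\<forall>s\<in>S. \<exists>\<omega>. good s \<omega> \<and> out (ids s) \<omega> (root s) = Some s \<and> leaf_labels s \<omega> = leaf_labels t \<omega>0"
    using \<omega>0(2) success_eventD(1)[OF \<omega>0(1)] unfolding bad_event_def bad_def by blast
  then obtain \<omega> where \<omega>: "\<And>s. s \<in> S \<Longrightarrow> good s (\<omega> s)"
      "\<And>s. s \<in> S \<Longrightarrow> out (ids s) (\<omega> s) (root s) = Some s"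
      "\<And>s. s \<in> S \<Longrightarrow> leaf_labels s (\<omega> s) = leaf_labels t \<omega>0" by metis
  define \<mu> where "\<mu> s z = the (out (ids s) (\<omega> s) (root s @ z))" for s z
  have "logstar_certificate P S (2 * T + 1) (\<lambda>_. Z) \<mu>"
    unfolding logstar_certificate_def
  proof (intro conjI ballI)
    show "S \<noteq> {}" using t by blast
    show "S \<subseteq> labels P" by (rule S(1))
    show "complete_tree \<delta> (2 * T + 1) Z"
      unfolding Z_def by (rule complete_tree_complete_nodes[OF \<delta>_pos])
    fix s assume s: "s \<in> S"
    show \<mu>_S: "\<mu> s ` Z \<subseteq> S" using \<omega>(1)[OF s] by (auto simp: good_def \<mu>_def)
    show "\<mu> s [] = s" using \<omega>(2)[OF s] by (simp add: \<mu>_def)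
    have corr: "correct P V (\<lambda>v. the (out (ids s) (\<omega> s) v))"
      using \<omega>(1)[OF s] success_eventD(3) by (simp add: good_def)
    show "correct P Z (\<mu> s)"
      unfolding correct_def
    proof (intro conjI ballI impI)
      show "\<mu> s ` Z \<subseteq> labels P" using \<mu>_S S(1) by blast
      fix z assume z: "z \<in> Z" "num_children Z z = \<delta>"
      then have len: "length z < 2 * T + 1"
        using \<delta>_pos num_children_complete_nodes[of z \<delta> "2 * T + 1"] by (auto simp: Z_def split: if_splits)
      have "num_children V (root s @ z) = \<delta>"
        using root s z len by (intro num_children_top) (auto simp: Z_def complete_nodes_def)
      then have "\<exists>\<rho>. \<rho> permutes {..<\<delta>} \<and> (the (out (ids s) (\<omega> s) (root s @ z)),
          map (\<lambda>i. the (out (ids s) (\<omega> s) ((root s @ z) @ [\<rho> i]))) [0..<\<delta>]) \<in> configs P"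
        using corr Z_V[OF s z(1)] unfolding correct_def by blast
      then show "\<exists>\<rho>. \<rho> permutes {..<\<delta>} \<and> (\<mu> s z, map (\<lambda>i. \<mu> s (z @ [\<rho> i])) [0..<\<delta>]) \<in> configs P"
        by (simp add: \<mu>_def)
    qed
    fix s' assume s': "s' \<in> S"
    show "leaf_labeled_iso Z (\<mu> s) Z (\<mu> s')"
      unfolding leaf_labeled_iso_def
    proof (intro exI[of _ id] conjI ballI impI)
      fix z assume z: "z \<in> Z" "leaf Z z"
      then have "z \<in> \<Lambda>"
        using \<delta>_pos num_children_complete_nodes[of z \<delta> "2 * T + 1"]
        by (auto simp: leaf_def \<Lambda>_def Z_def complete_nodes_def split: if_splits)
      then have "leaf_labels r (\<omega> r) z = out (ids r) (\<omega> r) (root r @ z)" for r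
        by (simp add: leaf_labels_def)
      then show "\<mu> s' (id z) = \<mu> s z"
        using fun_cong[OF \<omega>(3)[OF s], of z] fun_cong[OF \<omega>(3)[OF s'], of z] by (simp add: \<mu>_def)
    qed auto
  qed auto
  then show ?thesis unfolding has_logstar_certificate_def by blast
qed

end

subsection \<open>The lower bound\<close>

text \<open>The tree \<open>V\<close> only shows that its size is feasible; the algorithm is run on
  another tree of that size, complete down to depth \<open>4 * T + 3\<close>.\<close>

lemma fast_randomized_certificate:
  fixes A :: "(random_input, 's, 'm, 'a) algorithm"
  assumes lcl: "lcl P" and R: "poly_id_range R" and A: "rand_solves P R A"
    and time: "rand_time (arity P) R A (card V) \<le> enat T" and V: "full_tree (arity P) V"
    and large: "8 * (card (labels P) + 1)\<^sup>2 *
        (4 * card (complete_nodes (arity P) (4 * T + 3)) * (card (labels P) + 1)\<^sup>2) ^ (card (labels P) + 1)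
      \<le> card V"
  shows "has_logstar_certificate P"
proof -
  let ?N = "card (complete_nodes (arity P) (4 * T + 3))" and ?M = "card (labels P) + 1"
  have "?N * 1 \<le> ?N * (4 * ?M\<^sup>2)" by (intro mult_le_mono2) simp
  also have "\<dots> = 4 * ?N * ?M\<^sup>2" by simp
  also have "\<dots> \<le> (4 * ?N * ?M\<^sup>2) ^ ?M"
  proof -
    have "x \<le> x ^ (l + 1)" for x l :: nat by (cases "x = 0") auto
    then show ?thesis .
  qed
  also have "\<dots> \<le> 8 * ?M\<^sup>2 * (4 * ?N * ?M\<^sup>2) ^ ?M"
  proof -
    have "x \<le> 8 * (m + 1)\<^sup>2 * x" for x m :: nat by (simp add: power2_eq_square)
    then show ?thesis .
  qed
  finally have "?N \<le> card V" using large by linarith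
  moreover have "1 \<le> arity P" using lcl by (simp add: lcl_def)
  ultimately obtain W where W: "full_tree (arity P) W" "card W = card V"
    and top: "\<And>u. length u \<le> 4 * T + 3 \<Longrightarrow> u \<in> W \<longleftrightarrow> set u \<subseteq> {..<arity P}"
    using ex_full_tree_complete_top[OF _ V] by blast
  have inst: "(W, ids) \<in> instances (arity P) R (card V)"
    if "inj_on ids W" "ids ` W \<subseteq> {1..R (card V)}" for ids
    using that W by (simp add: instances_def)
  have rs: "(\<forall>v\<in>W. (\<lambda>\<omega>. final_output A W (random_input W ids \<omega>) v)
        \<in> measurable (random_bits W) (count_space UNIV)) \<and>
      measure (random_bits W) {\<omega> \<in> space (random_bits W). solved P A W (random_input W ids \<omega>)}
        \<ge> 1 - 1 / real (card V)"
    if "inj_on ids W" "ids ` W \<subseteq> {1..R (card V)}" for ids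
    using A inst[OF that] unfolding rand_solves_def by blast
  interpret fast_solver P A W "{1..R (card V)}" T
  proof
    show "card W \<le> card {1..R (card V)}" using R W(2) by (simp add: poly_id_range_def)
    fix ids v \<omega> assume ids: "inj_on ids W" "ids ` W \<subseteq> {1..R (card V)}" and v: "v \<in> W"
      and \<omega>: "\<omega> \<in> space (random_bits W)"
    have "rounds A W (random_input W ids \<omega>) \<le>
        (SUP \<omega>\<in>space (random_bits W). rounds A W (random_input W ids \<omega>))"
      using \<omega> by (rule SUP_upper)
    also have "\<dots> \<le> rand_time (arity P) R A (card V)"
      unfolding rand_time_def using inst[OF ids] by (intro SUP_upper2[of "(W, ids)"]) auto
    also note time
    finally show "\<exists>t\<le>T. has_output A W (random_input W ids \<omega>) t v"
      using v by (rule rounds_le_enatD)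
  qed (use lcl W top large rs in auto)
  show ?thesis by (rule certificate)
qed

lemma rand_complexity_finiteD:
  assumes "rand_complexity TYPE('s) TYPE('m) P R n = enat T"
  obtains A :: "(random_input, 's, 'm, 'a) algorithm"
  where "rand_solves P R A" "rand_time (arity P) R A n \<le> enat T"
proof -
  \<comment> \<open>A strict upper bound on the infimum yields an algorithm below it.\<close>
  have "rand_complexity TYPE('s) TYPE('m) P R n < enat (Suc T)" using assms by simp
  then obtain A :: "(random_input, 's, 'm, 'a) algorithm"
    where "rand_solves P R A" "rand_time (arity P) R A n < enat (Suc T)"
    unfolding rand_complexity_def by (auto simp: INF_less_iff)
  moreover from this have "rand_time (arity P) R A n \<le> enat T"
    by (cases "rand_time (arity P) R A n") auto
  ultimately show ?thesis using that by blast
qed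

text \<open>Without a certificate \<open>n\<close> is less than \<open>K * Q ^ T\<close>. Taking
  logarithms bounds \<open>T\<close> from below, and \<open>n\<close> being at least the square of
  \<open>K\<close> absorbs \<open>ln K\<close> into half of \<open>ln n\<close>.\<close>

lemma Omega_log_rand_complexity:
  fixes P :: "'a lcl_problem"
  assumes lcl: "lcl P" and R: "poly_id_range R" and none: "\<not> has_logstar_certificate P"
  shows "Omega_log (arity P) (rand_complexity TYPE('s) TYPE('m) P R)"
proof -
  define M where "M = card (labels P) + 1"
  define b where "b = arity P + 1"
  \<comment> \<open>Bounding the complete tree by \<open>b ^ (4 * T + 3)\<close> turns the size
    condition into \<open>K * Q ^ T\<close>: \<open>K\<close> collects the factors independent of
    \<open>T\<close>.\<close>
  define K where "K = 8 * M\<^sup>2 * (4 * b ^ 3 * M\<^sup>2) ^ M"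
  define Q where "Q = b ^ (4 * M)"
  have b: "2 \<le> b" using lcl by (simp add: lcl_def b_def)
  have M: "1 \<le> M" by (simp add: M_def)
  have Q: "1 < Q" unfolding Q_def using b M by (intro one_less_power) auto
  have K: "1 \<le> K" using b M by (simp add: K_def)
  have lower: "real (card V) < real K * real Q ^ T"
    if V: "full_tree (arity P) V" and T: "rand_complexity TYPE('s) TYPE('m) P R (card V) = enat T" for V T
  proof (rule ccontr)
    assume "\<not> ?thesis"
    then have "real (K * Q ^ T) \<le> real (card V)" by simp
    then have le: "K * Q ^ T \<le> card V" by (simp only: of_nat_le_iff)
    obtain A :: "(random_input, 's, 'm, 'a) algorithm"
      where A: "rand_solves P R A" "rand_time (arity P) R A (card V) \<le> enat T"
      by (rule rand_complexity_finiteD[OF T])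
    have "8 * M\<^sup>2 * (4 * card (complete_nodes (arity P) (4 * T + 3)) * M\<^sup>2) ^ M
        \<le> 8 * M\<^sup>2 * (4 * b ^ (4 * T + 3) * M\<^sup>2) ^ M"
      using card_complete_nodes_le[of "arity P" "4 * T + 3"]
      by (intro mult_le_mono power_mono) (auto simp: b_def)
    also have "\<dots> = K * Q ^ T"
      unfolding K_def Q_def
      by (simp add: power_add power_mult_distrib power_mult [symmetric] ac_simps)
    also note le
    finally have "has_logstar_certificate P"
      unfolding M_def by (rule fast_randomized_certificate[OF lcl R A V])
    with none show False ..
  qed
  have lnQ: "0 < ln (real Q)" using Q by simp
  show ?thesis
    unfolding Omega_log_def
  proof (intro exI conjI allI impI)
    show "0 < 1 / (2 * ln (real Q))" using lnQ by simp
    fix n assume n: "K\<^sup>2 \<le> n" and "\<exists>V. full_tree (arity P) V \<and> card V = n"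
    then obtain V where V: "full_tree (arity P) V" "card V = n" by blast
    show "ereal (1 / (2 * ln (real Q)) * ln (real n))
        \<le> ereal_of_enat (rand_complexity TYPE('s) TYPE('m) P R n)"
    proof (cases "rand_complexity TYPE('s) TYPE('m) P R n")
      case (enat T)
      have npos: "0 < real n" using n K by (simp add: order.strict_trans2[of 0 "K\<^sup>2"])
      have "ln (real n) < ln (real K * real Q ^ T)"
        using lower[OF V(1)] enat V(2) npos by (subst ln_less_cancel_iff) auto
      moreover have "ln (real K * real Q ^ T) = ln (real K) + real T * ln (real Q)"
        using K Q by (simp add: ln_mult ln_realpow)
      moreover have "2 * ln (real K) \<le> ln (real n)"
      proof -
        have "2 * ln (real K) = ln ((real K)\<^sup>2)" using K by (simp add: ln_realpow)
        also have "\<dots> \<le> ln (real n)"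
          using of_nat_mono[OF n, where 'a = real] K npos by (subst ln_le_cancel_iff) auto
        finally show ?thesis .
      qed
      ultimately have "ln (real n) \<le> 2 * (real T * ln (real Q))" by linarith
      then show ?thesis using enat lnQ by (simp add: field_simps)
    qed simp
  qed
qed

section \<open>Deterministic algorithms as randomized ones\<close>

definition ignore_bits :: "('i, 's, 'm, 'a) algorithm \<Rightarrow> ('i \<times> 'r, 's, 'm, 'a) algorithm" where
  "ignore_bits A = \<lparr>init = (\<lambda>x. init A (fst x)), send = send A, step = step A, decision = decision A\<rparr>"

lemma ignore_bits_simps [simp]:
  "init (ignore_bits A) x = init A (fst x)" "send (ignore_bits A) = send A"
  "step (ignore_bits A) = step A" "decision (ignore_bits A) = decision A"
  by (simp_all add: ignore_bits_def)

lemma inbox_ignore_bits [simp]: "inbox (ignore_bits A) V s v = inbox A V s v"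
proof
  show "inbox (ignore_bits A) V s v e = inbox A V s v e" for e by (cases e) simp_all
qed

lemma state_ignore_bits: "state (ignore_bits A) V x t = state A V (fst \<circ> x) t"
  by (induction t) simp_all

lemma has_output_ignore_bits: "has_output (ignore_bits A) V x t v \<longleftrightarrow> has_output A V (fst \<circ> x) t v"
  by (simp add: has_output_def state_ignore_bits)

lemma final_output_ignore_bits: "final_output (ignore_bits A) V x v = final_output A V (fst \<circ> x) v"
  by (simp add: final_output_def has_output_ignore_bits state_ignore_bits)

lemma fst_random_input: "fst \<circ> random_input V ids \<omega> = local_input V ids"
  by (auto simp: random_input_def)

text \<open>Ignoring the bits keeps the states, messages and running time of a deterministic
  algorithm, and its success probability is 1.\<close>

lemma rand_complexity_le_det_complexity:
  "rand_complexity TYPE('s) TYPE('m) P R n \<le> det_complexity TYPE('s) TYPE('m) P R n"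
  unfolding det_complexity_def
proof (rule INF_greatest)
  fix A :: "(local_input, 's, 'm, 'a) algorithm"
  assume "A \<in> {A. det_solves P R A}"
  then have A: "det_solves P R A" by simp
  have "rand_solves P R (ignore_bits A)"
    unfolding rand_solves_def
  proof (intro allI ballI)
    fix k inst assume inst: "inst \<in> instances (arity P) R k"
    obtain V ids where eq: "inst = (V, ids)" by (cases inst)
    have sol: "solved P A V (local_input V ids)" using A inst eq unfolding det_solves_def by blast
    interpret prob_space "random_bits V" by (rule prob_space_random_bits)
    have "{\<omega> \<in> space (random_bits V). solved P (ignore_bits A) V (random_input V ids \<omega>)} = space (random_bits V)"
      using sol by (simp add: solved_def final_output_ignore_bits fst_random_input)
    then show "case inst of (V, ids) \<Rightarrow>
        (\<forall>v\<in>V. (\<lambda>\<omega>. final_output (ignore_bits A) V (random_input V ids \<omega>) v)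
          \<in> measurable (random_bits V) (count_space UNIV)) \<and>
        1 - 1 / real k \<le> measure (random_bits V)
          {\<omega> \<in> space (random_bits V). solved P (ignore_bits A) V (random_input V ids \<omega>)}"
      by (simp add: eq final_output_ignore_bits fst_random_input prob_space)
  qed
  then have "rand_complexity TYPE('s) TYPE('m) P R n \<le> rand_time (arity P) R (ignore_bits A) n"
    unfolding rand_complexity_def by (intro INF_lower) simp
  also have "\<dots> \<le> det_time (arity P) R A n"
    unfolding rand_time_def det_time_def
  proof (rule SUP_mono)
    fix inst assume inst: "inst \<in> instances (arity P) R n"
    have "(case inst of (V, ids) \<Rightarrow> SUP \<omega>\<in>space (random_bits V). rounds (ignore_bits A) V (random_input V ids \<omega>))
        \<le> (case inst of (V, ids) \<Rightarrow> rounds A V (local_input V ids))"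
      by (auto simp: rounds_def has_output_ignore_bits fst_random_input intro!: SUP_least split: prod.split)
    then show "\<exists>i\<in>instances (arity P) R n.
        (case inst of (V, ids) \<Rightarrow> SUP \<omega>\<in>space (random_bits V). rounds (ignore_bits A) V (random_input V ids \<omega>))
        \<le> (case i of (V, ids) \<Rightarrow> rounds A V (local_input V ids))"
      using inst by blast
  qed
  finally show "rand_complexity TYPE('s) TYPE('m) P R n \<le> det_time (arity P) R A n" .
qed

lemma Omega_log_mono:
  assumes "Omega_log \<delta> f" "\<And>n. f n \<le> g n"
  shows "Omega_log \<delta> g"
  using assms unfolding Omega_log_def by (meson ereal_of_enat_le_iff order_trans)

theorem lemma6p7:
  fixes P :: "'a lcl_problem" and R :: "nat \<Rightarrow> nat"
  assumes "lcl P"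
    and "poly_id_range R"
    and "\<not> has_logstar_certificate P"
  shows "Omega_log (arity P) (rand_complexity TYPE('s) TYPE('m) P R) \<and>
         Omega_log (arity P) (det_complexity TYPE('s) TYPE('m) P R)"
  using Omega_log_rand_complexity[OF assms]
    Omega_log_mono[OF Omega_log_rand_complexity[OF assms] rand_complexity_le_det_complexity]
  by blast

end
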